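(* Assume that $X$ is Harris recurrent, that $f:E\to\mathbb R$ is measurable with $\langle\pi,f^2\rangle<\infty$, and that there exists a solution $F$ to the Poisson equation $F-PF=f-\langle\pi,f\rangle$ such that $\langle\pi,F^2\rangle<\infty$. Consider the Boltzmann case, i.e. the selection kernel $\kappa$ is the Boltzmann selection kernel $\kappa^B$. For $\beta(x,A,y)$ respectively equal to $F(y)$ and $f(y)$, one has $$\sigma(f,F)^2=\frac12\big(\sigma(f)^2-\mathrm{Var}_\pi(f)\big)\quad\text{and}\quad\sigma(f,f)^2=\sigma(f)^2-\Delta(f).$$ The non-negative term $\Delta(f)$ is positive when $\mathrm{Var}_\pi(f)>0$. Furthermore, if $\mathrm{Var}_\pi(f)>0$, then $\langle\pi,f^2-fPf\rangle=\frac12\mathbb E_\pi\big[(f(X_0)-f(X_1))^2\big]$ is positive, the function $b\mapsto\sigma(f,bf)^2$ (on $\mathbb R$) is minimal at $$b_\star=\frac{\langle\pi,f^2\rangle-\langle\pi,f\rangle^2}{\langle\pi,f^2-fPf\rangle},$$ and $b_\star>1$ when $\sigma(f,f)^2>0$.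
   Context: Let $(E,\mathcal F_E)$ be a measurable space with $\{x\}\in\mathcal F_E$ for all $x\in E$, and $\pi$ a probability measure on $E$. For a measure $\nu$ and a function $h$, $\langle\nu,h\rangle=\int\nu(dy)h(y)$; $\mathrm{Var}_\nu(h)=\langle\nu,h^2\rangle-\langle\nu,h\rangle^2$. $\mathbb E_\pi$ is expectation when $X_0$ has law $\pi$. Let $\mathcal P$ be the set of finite subsets of $E$. Let $\bar E=\bigcup_{n\ge1}E^n$ with the smallest $\sigma$-field $\mathcal F_{\bar E}$ containing all $A_1\times\cdots\times A_n$, $A_i\in\mathcal F_E$, $n\ge1$. Let $\Gamma:\bar E\to\mathcal P$ map $(x_1,\dots,x_n)$ to the set $\{x_1,\dots,x_n\}$, and let $\mathcal F_{\mathcal P}$ be the $\sigma$-field on $\mathcal P$ that is the image of $\mathcal F_{\bar E}$ by $\Gamma$ (i.e. $B\in\mathcal F_{\mathcal P}$ iff $\Gamma^{-1}(B)\in\mathcal F_{\bar E}$). Proposition kernel: a measurable probability kernel $\mathcal Q:E\times\mathcal F_{\mathcal P}\to[0,1]$ with $\int_{\mathcal P}\mathcal Q(x,dA)=1$ and $\int_{\mathcal P}\mathcal Q(x,dA)\mathbf 1_{\{x\notin A\}}=0$ for all $x$. A selection kernel is a measurable probability kernel $\kappa:E\times\mathcal P\times\mathcal F_E\to[0,1]$ with $\kappa(x,A,A)=1$ for $x\in A$, written $\kappa(x,A,dy)=\sum_{z\in A}\kappa(x,A,z)\delta_z(dy)$, and satisfying $\pi(dx)\mathcal Q(x,dA)\kappa(x,A,dy)=\pi(dy)\mathcal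 Q(y,dA)\kappa(y,A,dx)$. Write $\kappa_{x,A}(dy)=\kappa(x,A,dy)$. Boltzmann selection kernel: let $N(dx,dA)=\pi(dx)\mathcal Q(x,dA)$ and let $N_0(dA)$ be a measure on $\mathcal F_{\mathcal P}$ such that $\int_{x\in E}N(dx,dA)$ is absolutely continuous with respect to $N_0(dA)$. Since $x\in A$ and $A$ is finite $N(dx,dA)$-a.s., one has $N(dx,dA)=N_0(dA)\,r_A(dx)$ with $r_A(dx)=\sum_{y\in A}r_A(y)\delta_y(dx)$ and $(x,A)\mapsto r_A(x)\ge0$ jointly measurable. Then $$\kappa^B(x,A,y)=\kappa^B(A,y)=\frac{r_A(y)}{\sum_{z\in A}r_A(z)}\quad\text{for }x,y\in A,\ r_A\ne0,$$ and $\kappa^B(x,A,\cdot)$ is the uniform distribution on $A$ when $r_A=0$. It satisfies the reversibility condition $\pi(dx)\mathcal Q(x,dA)\kappa^B(x,A,dy)=\pi(dy)\mathcal Q(y,dA)\kappa^B(y,A,dx)$. Markov chain: given the past up to step $n$, $A_{n+1}$ is distributed according to $\mathcal Q(X_n,\cdot)$, then $X_{n+1}$ according to $\kappa(X_n,A_{n+1},\cdot)$. Its transition kernel is $P(x,dy)=\int_{\mathcal P}\mathcal Q(x,dA)\kappa(x,A,dy)$, reversible with respect to $\pi$; $Ph(x)=\int P(x,dy)h(y)$. Harris recurrence means: for all $B\in\mathcal F_E$ with $\pi(B)>0$ and all $x\in E$, $\mathbb P(\mathrm{Card}\{n\ge0:X_n\in B\}=\infty\mid X_0=x)=1$. Asymptotic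 variances: $\sigma(f)^2=\langle\pi,F^2-(PF)^2\rangle$ is that of $I_n(f)=\frac1n\sum_{k=1}^nf(X_k)$. For measurable $\psi:E\to\mathbb R$ with $\langle\pi,\psi^2\rangle<\infty$ (corresponding to $\beta(x,A,y)=\psi(y)$), $$\sigma(f,\psi)^2=\sigma(f)^2+\int\pi(dx)\mathcal Q(x,dA)\big[\mathrm{Var}_{\kappa_{x,A}}(\psi-F)-\mathrm{Var}_{\kappa_{x,A}}(F)\big]$$ is that of $I_n(f)+\frac1n\sum_{k=0}^{n-1}\big(\sum_{\tilde x\in A_{k+1}}\kappa(X_k,A_{k+1},\tilde x)\psi(\tilde x)-\psi(X_{k+1})\big)$. With $f_0=f-\langle\pi,f\rangle$, $$\Delta(f)=\frac12\int\pi(dx)P(x,dy)(f_0(x)+f_0(y))^2=\langle\pi,f_0(f_0+Pf_0)\rangle.$$ *)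

theory Defs
  imports "HOL-Probability.Probability"
begin

section \<open>Finite subsets of a measurable space\<close>

text \<open>The measurable space \<open>E\<close> is read off from a measure \<open>M\<close> on it; in the applications
  this is the target distribution \<open>\<pi>\<close>, so that \<open>E\<close> is \<^term>\<open>space \<pi>\<close> and
  its sigma-field is \<^term>\<open>sets \<pi>\<close>.\<close>

text \<open>\<open>\<Union>\<^sub>n\<^sub>\<ge>\<^sub>1 E\<^sup>n\<close>, with tuples rendered as nonempty lists.\<close>

definition tuple_space :: "'a measure \<Rightarrow> 'a list measure" where
  "tuple_space M = sigma {xs. xs \<noteq> [] \<and> set xs \<subseteq> space M}
     {listset As | As. As \<noteq> [] \<and> set As \<subseteq> sets M}"

text \<open>The image sigma-field under \<open>(x\<^sub>1, \<dots>, x\<^sub>n) \<mapsto> {x\<^sub>1, \<dots>, x\<^sub>n}\<close>, that is, under \<^const>\<open>set\<close>.\<close>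

definition finset_space :: "'a measure \<Rightarrow> 'a set measure" where
  "finset_space M = sigma {A. finite A \<and> A \<subseteq> space M}
     {B. B \<subseteq> {A. finite A \<and> A \<subseteq> space M} \<and>
         set -` B \<inter> space (tuple_space M) \<in> sets (tuple_space M)}"

lemma space_finset_space: "space (finset_space M) = {A. finite A \<and> A \<subseteq> space M}"
  unfolding finset_space_def by (rule space_measure_of) auto

lemma space_tuple_space: "space (tuple_space M) = {xs. xs \<noteq> [] \<and> set xs \<subseteq> space M}"
proof -
  have "set xs \<subseteq> \<Union>(set As) \<and> length xs = length As" if "xs \<in> listset As" for xs :: "'a list" and As
    using that by (induction As arbitrary: xs) (fastforce simp: set_Cons_def)+
  moreover have "\<Union>(set As) \<subseteq> space M" if "set As \<subseteq> sets M" for As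
    using that sets.sets_into_space by blast
  ultimately show ?thesis
    unfolding tuple_space_def by (intro space_measure_of) fastforce
qed

lemma sets_finset_space:
  "sets (finset_space M) =
     {B. B \<subseteq> {A. finite A \<and> A \<subseteq> space M} \<and>
         set -` B \<inter> space (tuple_space M) \<in> sets (tuple_space M)}"
proof -
  let ?P = "{A. finite A \<and> A \<subseteq> space M}" and ?T = "tuple_space M"
  let ?S = "{B. B \<subseteq> ?P \<and> set -` B \<inter> space ?T \<in> sets ?T}"
  have "sigma_algebra ?P ?S"
  proof (intro sigma_algebra_iff2[THEN iffD2] conjI ballI allI impI)
    fix B assume B: "B \<in> ?S"
    have "set -` (?P - B) \<inter> space ?T = space ?T - (set -` B \<inter> space ?T)"
      by (auto simp: space_tuple_space)
    with B show "?P - B \<in> ?S" by auto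
  next
    fix B :: "nat \<Rightarrow> 'a set set" assume B: "range B \<subseteq> ?S"
    have "set -` (\<Union>i. B i) \<inter> space ?T = (\<Union>i. set -` B i \<inter> space ?T)" by auto
    moreover have "\<dots> \<in> sets ?T" using B by (intro sets.countable_UN) auto
    moreover have "(\<Union>i. B i) \<subseteq> ?P" using B by blast
    ultimately show "(\<Union>i. B i) \<in> ?S" by simp
  qed auto
  then show ?thesis
    unfolding finset_space_def by (rule sigma_algebra.sets_measure_of_eq)
qed


section \<open>Kernels\<close>

text \<open>The measure \<open>M(dx) K(x, dy)\<close> on the product space.\<close>

definition kernel_prod ::
  "'a measure \<Rightarrow> 'b measure \<Rightarrow> ('a \<Rightarrow> 'b measure) \<Rightarrow> ('a \<times> 'b) measure" where
  "kernel_prod M N K = M \<bind> (\<lambda>x. distr (K x) (M \<Otimes>\<^sub>M N) (Pair x))"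

definition variance_of :: "'a measure \<Rightarrow> ('a \<Rightarrow> real) \<Rightarrow> real" where
  "variance_of \<nu> h = (\<integral>y. (h y)\<^sup>2 \<partial>\<nu>) - (\<integral>y. h y \<partial>\<nu>)\<^sup>2"

definition proposition_kernel :: "'a measure \<Rightarrow> ('a \<Rightarrow> 'a set measure) \<Rightarrow> bool" where
  "proposition_kernel \<pi> Q \<longleftrightarrow>
     Q \<in> \<pi> \<rightarrow>\<^sub>M prob_algebra (finset_space \<pi>) \<and>
     (\<forall>x\<in>space \<pi>. (\<integral>\<^sup>+A. indicator {A. x \<notin> A} A \<partial>Q x) = 0)"

text \<open>\<open>N(dx, dA) = \<pi>(dx) Q(x, dA)\<close>\<close>

definition proposal_law ::
  "'a measure \<Rightarrow> ('a \<Rightarrow> 'a set measure) \<Rightarrow> ('a \<times> 'a set) measure" where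
  "proposal_law \<pi> Q = kernel_prod \<pi> (finset_space \<pi>) Q"

text \<open>\<open>\<pi>(dx) Q(x, dA) \<kappa>(x, A, dy)\<close>\<close>

definition triple_law ::
  "'a measure \<Rightarrow> ('a \<Rightarrow> 'a set measure) \<Rightarrow> ('a \<Rightarrow> 'a set \<Rightarrow> 'a measure)
    \<Rightarrow> (('a \<times> 'a set) \<times> 'a) measure" where
  "triple_law \<pi> Q \<kappa> = kernel_prod (proposal_law \<pi> Q) \<pi> (\<lambda>(x, A). \<kappa> x A)"

definition selection_kernel ::
  "'a measure \<Rightarrow> ('a \<Rightarrow> 'a set measure) \<Rightarrow> ('a \<Rightarrow> 'a set \<Rightarrow> 'a measure) \<Rightarrow> bool" where
  "selection_kernel \<pi> Q \<kappa> \<longleftrightarrow>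
     (\<lambda>(x, A). \<kappa> x A) \<in> \<pi> \<Otimes>\<^sub>M finset_space \<pi> \<rightarrow>\<^sub>M prob_algebra \<pi> \<and>
     (\<forall>A\<in>space (finset_space \<pi>). \<forall>x\<in>A. measure (\<kappa> x A) A = 1) \<and>
     distr (triple_law \<pi> Q \<kappa>) (triple_law \<pi> Q \<kappa>) (\<lambda>((x, A), y). ((y, A), x))
       = triple_law \<pi> Q \<kappa>"

text \<open>\<open>N\<^sub>0\<close> is a reference measure for the \<open>A\<close>-marginal of \<open>N\<close>, and \<open>r A x\<close> is the mass
  \<open>r\<^sub>A(x)\<close>; only its values at \<open>x \<in> A\<close> enter the measure \<open>r\<^sub>A\<close>.\<close>

definition boltzmann_disintegration ::
  "'a measure \<Rightarrow> ('a \<Rightarrow> 'a set measure) \<Rightarrow> 'a set measure \<Rightarrow> ('a set \<Rightarrow> 'a \<Rightarrow> real) \<Rightarrow> bool" where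
  "boltzmann_disintegration \<pi> Q N\<^sub>0 r \<longleftrightarrow>
     sets N\<^sub>0 = sets (finset_space \<pi>) \<and>
     absolutely_continuous N\<^sub>0 (distr (proposal_law \<pi> Q) (finset_space \<pi>) snd) \<and>
     (\<lambda>(x, A). r A x) \<in> borel_measurable (\<pi> \<Otimes>\<^sub>M finset_space \<pi>) \<and>
     (\<forall>A\<in>space (finset_space \<pi>). \<forall>x\<in>space \<pi>. 0 \<le> r A x) \<and>
     (\<forall>D\<in>sets (\<pi> \<Otimes>\<^sub>M finset_space \<pi>).
        emeasure (proposal_law \<pi> Q) D =
          (\<integral>\<^sup>+A. (\<Sum>y\<in>A. ennreal (r A y) * indicator D (y, A)) \<partial>N\<^sub>0))"

definition boltzmann_weight :: "('a set \<Rightarrow> 'a \<Rightarrow> real) \<Rightarrow> 'a set \<Rightarrow> 'a \<Rightarrow> real" where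
  "boltzmann_weight r A y =
     (if \<exists>z\<in>A. r A z \<noteq> 0 then r A y / (\<Sum>z\<in>A. r A z) else 1 / real (card A))"

text \<open>\<open>\<kappa>(x, A, \<cdot>)\<close> is only prescribed for \<open>x \<in> A\<close>, which holds almost surely under \<open>N\<close>.\<close>

definition is_boltzmann_kernel ::
  "'a measure \<Rightarrow> ('a set \<Rightarrow> 'a \<Rightarrow> real) \<Rightarrow> ('a \<Rightarrow> 'a set \<Rightarrow> 'a measure) \<Rightarrow> bool" where
  "is_boltzmann_kernel \<pi> r \<kappa> \<longleftrightarrow>
     (\<forall>A\<in>space (finset_space \<pi>). \<forall>x\<in>A. \<forall>y\<in>A.
        measure (\<kappa> x A) {y} = boltzmann_weight r A y)"


section \<open>The Markov chain\<close>

definition transition_kernel ::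
  "('a \<Rightarrow> 'a set measure) \<Rightarrow> ('a \<Rightarrow> 'a set \<Rightarrow> 'a measure) \<Rightarrow> 'a \<Rightarrow> 'a measure" where
  "transition_kernel Q \<kappa> x = Q x \<bind> \<kappa> x"

definition kernel_op :: "('a \<Rightarrow> 'a measure) \<Rightarrow> ('a \<Rightarrow> real) \<Rightarrow> 'a \<Rightarrow> real" where
  "kernel_op P h x = (\<integral>y. h y \<partial>P x)"

text \<open>The chain is realised on the space of paths \<open>n \<mapsto> (A\<^sub>n, X\<^sub>n)\<close>: given the past up to step \<open>n\<close>,
  the pair \<open>(A\<^sub>n\<^sub>+\<^sub>1, X\<^sub>n\<^sub>+\<^sub>1)\<close> has law \<open>Q(X\<^sub>n, dA) \<kappa>(X\<^sub>n, A, dy)\<close>. As there is no proposition at time 0,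
  \<open>A\<^sub>0\<close> is set to the empty set and plays no role; \<open>X\<^sub>0\<close> has law \<open>\<mu>\<close>.\<close>

primrec chain_kernel ::
  "'a measure \<Rightarrow> ('a \<Rightarrow> 'a set measure) \<Rightarrow> ('a \<Rightarrow> 'a set \<Rightarrow> 'a measure) \<Rightarrow> 'a measure
    \<Rightarrow> nat \<Rightarrow> (nat \<Rightarrow> 'a set \<times> 'a) \<Rightarrow> ('a set \<times> 'a) measure" where
  "chain_kernel \<pi> Q \<kappa> \<mu> 0 \<omega> = distr \<mu> (finset_space \<pi> \<Otimes>\<^sub>M \<pi>) (\<lambda>x. ({}, x))"
| "chain_kernel \<pi> Q \<kappa> \<mu> (Suc n) \<omega> =
     (let x = snd (\<omega> n) in kernel_prod (Q x) \<pi> (\<kappa> x))"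

text \<open>The law of the whole path, by the Ionescu-Tulcea theorem.\<close>

definition chain_law ::
  "'a measure \<Rightarrow> ('a \<Rightarrow> 'a set measure) \<Rightarrow> ('a \<Rightarrow> 'a set \<Rightarrow> 'a measure) \<Rightarrow> 'a measure
    \<Rightarrow> (nat \<Rightarrow> 'a set \<times> 'a) measure" where
  "chain_law \<pi> Q \<kappa> \<mu> =
     projective_family.lim UNIV
       (Ionescu_Tulcea.CI (chain_kernel \<pi> Q \<kappa> \<mu>) (\<lambda>_. finset_space \<pi> \<Otimes>\<^sub>M \<pi>))
       (\<lambda>_. finset_space \<pi> \<Otimes>\<^sub>M \<pi>)"

lemma measurable_kernel_prod:
  assumes Q: "Q \<in> M \<rightarrow>\<^sub>M prob_algebra N"
    and K: "(\<lambda>(x, A). K x A) \<in> M \<Otimes>\<^sub>M N \<rightarrow>\<^sub>M prob_algebra L"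
  shows "(\<lambda>x. kernel_prod (Q x) L (K x)) \<in> M \<rightarrow>\<^sub>M prob_algebra (N \<Otimes>\<^sub>M L)"
proof -
  have "(\<lambda>x. Q x \<bind> (\<lambda>A. distr (K x A) (N \<Otimes>\<^sub>M L) (Pair A))) \<in> M \<rightarrow>\<^sub>M prob_algebra (N \<Otimes>\<^sub>M L)"
  proof (rule measurable_bind_prob_space2[OF Q])
    have "(\<lambda>(z, y). (snd z, y)) \<in> (M \<Otimes>\<^sub>M N) \<Otimes>\<^sub>M L \<rightarrow>\<^sub>M N \<Otimes>\<^sub>M L" by measurable
    from measurable_distr_prob_space2[OF K this]
    show "(\<lambda>(x, A). distr (K x A) (N \<Otimes>\<^sub>M L) (Pair A)) \<in> M \<Otimes>\<^sub>M N \<rightarrow>\<^sub>M prob_algebra (N \<Otimes>\<^sub>M L)"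
      by (simp add: case_prod_beta')
  qed
  moreover have "kernel_prod (Q x) L (K x) = Q x \<bind> (\<lambda>A. distr (K x A) (N \<Otimes>\<^sub>M L) (Pair A))"
    if "x \<in> space M" for x
  proof -
    have "sets (Q x) = sets N"
      using measurable_space[OF Q that] by (simp add: space_prob_algebra)
    then have "sets (Q x \<Otimes>\<^sub>M L) = sets (N \<Otimes>\<^sub>M L)" by (rule sets_pair_measure_cong) simp
    then show ?thesis
      unfolding kernel_prod_def by (metis (no_types, lifting) distr_cong)
  qed
  ultimately show ?thesis by (simp cong: measurable_cong)
qed

lemma Ionescu_Tulcea_chain:
  assumes Q: "proposition_kernel \<pi> Q" and \<kappa>: "selection_kernel \<pi> Q \<kappa>"
    and \<mu>: "prob_space \<mu>" "sets \<mu> = sets \<pi>"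
  shows "Ionescu_Tulcea (chain_kernel \<pi> Q \<kappa> \<mu>) (\<lambda>_. finset_space \<pi> \<Otimes>\<^sub>M \<pi>)"
proof -
  let ?S = "finset_space \<pi> \<Otimes>\<^sub>M \<pi>"
  have "chain_kernel \<pi> Q \<kappa> \<mu> i \<in> PiM {0..<i} (\<lambda>_. ?S) \<rightarrow>\<^sub>M prob_algebra ?S" for i
  proof (cases i)
    case 0
    have "{} \<in> space (finset_space \<pi>)" by (simp add: space_finset_space)
    then have "(\<lambda>x. ({}, x)) \<in> \<mu> \<rightarrow>\<^sub>M ?S"
      by (intro measurable_Pair measurable_const) (simp_all add: measurable_ident_sets \<mu>)
    then have "distr \<mu> ?S (\<lambda>x. ({}, x)) \<in> space (prob_algebra ?S)"
      by (simp add: space_prob_algebra prob_space.prob_space_distr[OF \<mu>(1)])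
    moreover have "chain_kernel \<pi> Q \<kappa> \<mu> i = (\<lambda>_. distr \<mu> ?S (\<lambda>x. ({}, x)))"
      by (rule ext) (simp add: 0)
    ultimately show ?thesis by (metis measurable_const)
  next
    case (Suc n)
    have "(\<lambda>x. kernel_prod (Q x) \<pi> (\<kappa> x)) \<in> \<pi> \<rightarrow>\<^sub>M prob_algebra ?S"
      using Q \<kappa> by (intro measurable_kernel_prod)
        (auto simp: proposition_kernel_def selection_kernel_def)
    moreover have "(\<lambda>\<omega>. snd (\<omega> n)) \<in> PiM {0..<i} (\<lambda>_. ?S) \<rightarrow>\<^sub>M \<pi>"
      by (rule measurable_compose[where g = snd and N = ?S])
         (simp_all add: Suc measurable_component_singleton)
    moreover have "chain_kernel \<pi> Q \<kappa> \<mu> i = (\<lambda>\<omega>. kernel_prod (Q (snd (\<omega> n))) \<pi> (\<kappa> (snd (\<omega> n))))"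
      by (rule ext) (simp add: Suc Let_def)
    ultimately show ?thesis
      using measurable_compose by force
  qed
  note K = this
  have "prob_space (chain_kernel \<pi> Q \<kappa> \<mu> i \<omega>)" if "\<omega> \<in> space (PiM {0..<i} (\<lambda>_. ?S))" for i \<omega>
    using measurable_space[OF K that] by (simp add: space_prob_algebra)
  then show ?thesis
    unfolding Ionescu_Tulcea_def using measurable_prob_algebraD[OF K] by blast
qed

definition harris_recurrent ::
  "'a measure \<Rightarrow> ('a \<Rightarrow> 'a set measure) \<Rightarrow> ('a \<Rightarrow> 'a set \<Rightarrow> 'a measure) \<Rightarrow> bool" where
  "harris_recurrent \<pi> Q \<kappa> \<longleftrightarrow>
     (\<forall>B\<in>sets \<pi>. measure \<pi> B > 0 \<longrightarrow>
        (\<forall>x\<in>space \<pi>.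
           \<P>(\<omega> in chain_law \<pi> Q \<kappa> (return \<pi> x). infinite {n. snd (\<omega> n) \<in> B}) = 1))"


section \<open>Asymptotic variances\<close>

definition poisson_solution ::
  "'a measure \<Rightarrow> ('a \<Rightarrow> 'a measure) \<Rightarrow> ('a \<Rightarrow> real) \<Rightarrow> ('a \<Rightarrow> real) \<Rightarrow> bool" where
  "poisson_solution \<pi> P f F \<longleftrightarrow>
     F \<in> borel_measurable \<pi> \<and>
     (\<forall>x\<in>space \<pi>. F x - kernel_op P F x = f x - (\<integral>y. f y \<partial>\<pi>))"

text \<open>\<open>\<sigma>(f)\<^sup>2\<close> and \<open>\<sigma>(f, \<psi>)\<^sup>2\<close>; they depend on \<open>f\<close> through the solution \<open>F\<close> of its
  Poisson equation.\<close>

definition asymp_var :: "'a measure \<Rightarrow> ('a \<Rightarrow> 'a measure) \<Rightarrow> ('a \<Rightarrow> real) \<Rightarrow> real" where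
  "asymp_var \<pi> P F = (\<integral>x. (F x)\<^sup>2 - (kernel_op P F x)\<^sup>2 \<partial>\<pi>)"

definition asymp_var_wr ::
  "'a measure \<Rightarrow> ('a \<Rightarrow> 'a set measure) \<Rightarrow> ('a \<Rightarrow> 'a set \<Rightarrow> 'a measure)
    \<Rightarrow> ('a \<Rightarrow> real) \<Rightarrow> ('a \<Rightarrow> real) \<Rightarrow> real" where
  "asymp_var_wr \<pi> Q \<kappa> F \<psi> =
     asymp_var \<pi> (transition_kernel Q \<kappa>) F +
     (\<integral>(x, A). variance_of (\<kappa> x A) (\<lambda>y. \<psi> y - F y) - variance_of (\<kappa> x A) F
        \<partial>proposal_law \<pi> Q)"

definition Delta :: "'a measure \<Rightarrow> ('a \<Rightarrow> 'a measure) \<Rightarrow> ('a \<Rightarrow> real) \<Rightarrow> real" where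
  "Delta \<pi> P f =
     (let f\<^sub>0 = (\<lambda>x. f x - (\<integral>y. f y \<partial>\<pi>))
      in 1 / 2 * (\<integral>(x, y). (f\<^sub>0 x + f\<^sub>0 y)\<^sup>2 \<partial>kernel_prod \<pi> \<pi> P))"

definition b_star :: "'a measure \<Rightarrow> ('a \<Rightarrow> 'a measure) \<Rightarrow> ('a \<Rightarrow> real) \<Rightarrow> real" where
  "b_star \<pi> P f =
     ((\<integral>x. (f x)\<^sup>2 \<partial>\<pi>) - (\<integral>x. f x \<partial>\<pi>)\<^sup>2) / (\<integral>x. (f x)\<^sup>2 - f x * kernel_op P f x \<partial>\<pi>)"

end

theory Submission
  imports Defs
begin

text \<open>The Boltzmann case enters through three facts: the triple law
  \<open>\<pi>(dx) Q(x, dA) \<kappa>(x, A, dy)\<close> is invariant under exchanging \<open>x\<close> and \<open>y\<close>, it is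
  carried by \<open>x, y \<in> A\<close>, and \<open>\<kappa>(x, A, \<cdot>)\<close> is the same measure for all \<open>x \<in> A\<close>.
  Write \<open>\<kappa>h(x, A)\<close> for \<open>\<integral> \<kappa>(x, A, dy) h(y)\<close>. Reversing the triple law gives
  \<open>\<langle>\<pi>, g Ph\<rangle> = \<integral> N(dx, dA) \<kappa>g(x, A) \<kappa>h(x, A)\<close>, so the mean conditional variance of \<open>h\<close> is the
  Dirichlet form \<open>D(h) = \<langle>\<pi>, h\<^sup>2 - h Ph\<rangle>\<close>. As \<open>F - PF = f\<^sub>0\<close>, this turns \<open>\<sigma>(f, h)\<^sup>2\<close> into
  \<open>\<sigma>(f)\<^sup>2 + D(h) - 2 \<langle>\<pi>, h f\<^sub>0\<rangle>\<close>, which yields both identities and the minimiser over \<open>b\<close>.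
  The representation also shows \<open>\<langle>\<pi>, f\<^sub>0 Pf\<^sub>0\<rangle> \<ge> 0\<close>, whence \<open>\<Delta>(f) \<ge> Var f\<close>.
  If \<open>D(f) = 0\<close>, then \<open>f\<close> is constant along the chain, so
  \<open>Var f = \<langle>\<pi>, f (F - PF)\<rangle> = 0\<close>. If \<open>\<langle>\<pi>, f\<^sub>0 Pf\<^sub>0\<rangle> = 0\<close>, then \<open>\<kappa>f\<^sub>0 = 0\<close> almost
  everywhere, hence \<open>\<langle>\<pi>, f\<^sub>0 PF\<rangle> = 0\<close> and \<open>\<sigma>(f, f)\<^sup>2 = 0\<close>.\<close>

section \<open>Iterated integration against \<open>kernel_prod\<close>\<close>

lemma measurable_distr_Pair:
  assumes "K \<in> M \<rightarrow>\<^sub>M prob_algebra N"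
  shows "(\<lambda>x. distr (K x) (M \<Otimes>\<^sub>M N) (Pair x)) \<in> M \<rightarrow>\<^sub>M prob_algebra (M \<Otimes>\<^sub>M N)"
  by (rule measurable_distr_prob_space2[OF assms]) simp

lemma prob_kernelD:
  assumes "K \<in> M \<rightarrow>\<^sub>M prob_algebra N" "x \<in> space M"
  shows "prob_space (K x)" "sets (K x) = sets N" "space (K x) = space N"
proof -
  show "prob_space (K x)" "sets (K x) = sets N"
    using measurable_space[OF assms] by (auto simp: space_prob_algebra)
  then show "space (K x) = space N" by (metis sets_eq_imp_space_eq)
qed

lemma measurable_Pair_kernel:
  assumes "K \<in> M \<rightarrow>\<^sub>M prob_algebra N" "x \<in> space M"
  shows "Pair x \<in> K x \<rightarrow>\<^sub>M M \<Otimes>\<^sub>M N"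
  using measurable_Pair1'[OF assms(2), of N] by (simp cong: measurable_cong_sets add: prob_kernelD[OF assms])

lemma sets_kernel_prod:
  assumes "K \<in> M \<rightarrow>\<^sub>M prob_algebra N" "space M \<noteq> {}"
  shows "sets (kernel_prod M N K) = sets (M \<Otimes>\<^sub>M N)"
  unfolding kernel_prod_def using assms by simp

lemma prob_space_kernel_prod:
  assumes "prob_space M" "K \<in> M \<rightarrow>\<^sub>M prob_algebra N"
  shows "prob_space (kernel_prod M N K)"
  unfolding kernel_prod_def
  by (rule prob_space_bind'[OF _ measurable_distr_Pair[OF assms(2)]])
     (simp add: space_prob_algebra assms)

lemma nn_integral_kernel_prod:
  assumes K: "K \<in> M \<rightarrow>\<^sub>M prob_algebra N" and g: "g \<in> borel_measurable (M \<Otimes>\<^sub>M N)"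
  shows "(\<integral>\<^sup>+z. g z \<partial>kernel_prod M N K) = (\<integral>\<^sup>+x. \<integral>\<^sup>+y. g (x, y) \<partial>K x \<partial>M)"
  unfolding kernel_prod_def
  by (subst nn_integral_bind[OF g measurable_prob_algebraD[OF measurable_distr_Pair[OF K]]])
     (auto intro!: nn_integral_cong nn_integral_distr measurable_Pair_kernel[OF K] simp: g)

lemma measurable_kernel_nn_integral:
  assumes K: "K \<in> M \<rightarrow>\<^sub>M prob_algebra N" and g: "g \<in> borel_measurable (M \<Otimes>\<^sub>M N)"
  shows "(\<lambda>x. \<integral>\<^sup>+y. g (x, y) \<partial>K x) \<in> borel_measurable M"
  by (rule nn_integral_measurable_subprob_algebra2[OF _ measurable_prob_algebraD[OF K]]) (simp add: g)

lemma measurable_kernel_integral: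
  fixes g :: "_ \<Rightarrow> real"
  assumes K: "K \<in> M \<rightarrow>\<^sub>M prob_algebra N" and g: "g \<in> borel_measurable (M \<Otimes>\<^sub>M N)"
  shows "(\<lambda>x. \<integral>y. g (x, y) \<partial>K x) \<in> borel_measurable M"
proof -
  have "(\<lambda>x. \<integral>z. g z \<partial>distr (K x) (M \<Otimes>\<^sub>M N) (Pair x)) \<in> borel_measurable M"
    by (rule measurable_compose[OF measurable_prob_algebraD[OF measurable_distr_Pair[OF K]]
          integral_measurable_subprob_algebra[OF g]])
  also have "?this \<longleftrightarrow> ?thesis"
    by (intro measurable_cong integral_distr measurable_Pair_kernel[OF K] g)
  finally show ?thesis .
qed

text \<open>The nonnegative case \<open>nn_integral_kernel_prod\<close> is applied to the positive
  and negative parts of \<open>g\<close>, whose integrals are finite; the signed statement is their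
  difference.\<close>

lemma
  fixes g :: "_ \<Rightarrow> real"
  assumes K: "K \<in> M \<rightarrow>\<^sub>M prob_algebra N" and ne: "space M \<noteq> {}" 
    and int: "integrable (kernel_prod M N K) g"
  shows AE_integrable_kernel: "AE x in M. integrable (K x) (\<lambda>y. g (x, y))" (is ?A)
    and integrable_kernel_integral: "integrable M (\<lambda>x. \<integral>y. g (x, y) \<partial>K x)" (is ?B)
    and integral_kernel_prod:
      "(\<integral>z. g z \<partial>kernel_prod M N K) = (\<integral>x. \<integral>y. g (x, y) \<partial>K x \<partial>M)" (is ?C)
proof -
  have g[measurable]: "g \<in> borel_measurable (M \<Otimes>\<^sub>M N)"
    using borel_measurable_integrable[OF int]
      measurable_cong_sets[OF sets_kernel_prod[OF K ne], of borel borel] by auto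
  have gx: "(\<lambda>y. g (x, y)) \<in> borel_measurable (K x)" if "x \<in> space M" for x
    using measurable_compose[OF measurable_Pair_kernel[OF K that] g] .
  note fin = int[unfolded integrable_iff_bounded, THEN conjunct2]
  define p n where "p x = (\<integral>\<^sup>+y. ennreal (g (x, y)) \<partial>K x)" and "n x = (\<integral>\<^sup>+y. ennreal (- g (x, y)) \<partial>K x)" for x
  have pn[measurable]: "p \<in> borel_measurable M" "n \<in> borel_measurable M"
    unfolding p_def n_def
    using measurable_kernel_nn_integral[OF K, of "\<lambda>z. ennreal (g z)"]
       measurable_kernel_nn_integral[OF K, of "\<lambda>z. ennreal (- g z)"] by auto
  have N: "(\<integral>\<^sup>+x. \<integral>\<^sup>+y. norm (g (x, y)) \<partial>K x \<partial>M) < \<infinity>"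
    using fin by (subst (asm) nn_integral_kernel_prod[OF K]) auto
  have P: "(\<integral>\<^sup>+z. ennreal (g z) \<partial>kernel_prod M N K) = (\<integral>\<^sup>+x. p x \<partial>M)"
     "(\<integral>\<^sup>+z. ennreal (- g z) \<partial>kernel_prod M N K) = (\<integral>\<^sup>+x. n x \<partial>M)"
    unfolding p_def n_def by (subst nn_integral_kernel_prod[OF K]; simp)+
  have Pf: "(\<integral>\<^sup>+x. p x \<partial>M) < \<infinity>" "(\<integral>\<^sup>+x. n x \<partial>M) < \<infinity>"
    using int[unfolded real_integrable_def] unfolding P by (auto simp: less_top)
  \<comment> \<open>Where \<open>g\<close> is not integrable in \<open>y\<close>, the Bochner
    integral is 0 by convention; such \<open>x\<close> form a null set.\<close>
  have "AE x in M. (\<integral>\<^sup>+y. norm (g (x, y)) \<partial>K x) \<noteq> \<infinity>"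
    using N by (intro nn_integral_noteq_infinite measurable_kernel_nn_integral[OF K, of "\<lambda>z. ennreal (norm (g z))"]) auto
  with AE_space show A: ?A
    by eventually_elim (auto simp: integrable_iff_bounded gx less_top)
  have eq: "AE x in M. (\<integral>y. g (x, y) \<partial>K x) = enn2real (p x) - enn2real (n x)"
    using A by eventually_elim (simp add: p_def n_def real_lebesgue_integral_def)
  have F: "AE x in M. p x \<noteq> \<infinity>" "AE x in M. n x \<noteq> \<infinity>"
    using Pf pn nn_integral_noteq_infinite[of p M] nn_integral_noteq_infinite[of n M] by auto
  have e: "(\<integral>\<^sup>+x. ennreal (enn2real (p x)) \<partial>M) = (\<integral>\<^sup>+x. p x \<partial>M)"
    "(\<integral>\<^sup>+x. ennreal (enn2real (n x)) \<partial>M) = (\<integral>\<^sup>+x. n x \<partial>M)"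
    using F by (auto intro!: nn_integral_cong_AE simp: less_top)
  have I: "integrable M (\<lambda>x. enn2real (p x))" "integrable M (\<lambda>x. enn2real (n x))"
    using Pf e by (auto simp: integrable_iff_bounded)
  have m: "(\<lambda>x. \<integral>y. g (x, y) \<partial>K x) \<in> borel_measurable M"
    by (rule measurable_kernel_integral[OF K g])
  show ?B
    using integrable_cong_AE[OF m _ eq] I by auto
  have "(\<integral>x. \<integral>y. g (x, y) \<partial>K x \<partial>M) = (\<integral>x. enn2real (p x) - enn2real (n x) \<partial>M)"
    using m by (intro integral_cong_AE eq) auto
  also have "\<dots> = enn2real (\<integral>\<^sup>+x. p x \<partial>M) - enn2real (\<integral>\<^sup>+x. n x \<partial>M)"
    using I by (simp add: integral_eq_nn_integral e)
  also have "\<dots> = (\<integral>z. g z \<partial>kernel_prod M N K)"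
    using int by (simp add: real_lebesgue_integral_def P)
  finally show ?C by simp
qed

text \<open>Each \<open>K x\<close> has total mass 1, so integrating out the second coordinate
  leaves \<open>M\<close>.\<close>

lemma distr_fst_kernel_prod:
  assumes K: "K \<in> M \<rightarrow>\<^sub>M prob_algebra N" and ne: "space M \<noteq> {}"
  shows "distr (kernel_prod M N K) M fst = M"
proof (rule measure_eqI)
  fix X assume "X \<in> sets (distr (kernel_prod M N K) M fst)"
  then have X[measurable]: "X \<in> sets M" by simp
  have [measurable_cong]: "sets (kernel_prod M N K) = sets (M \<Otimes>\<^sub>M N)"
    by (rule sets_kernel_prod[OF K ne])
  have "emeasure (distr (kernel_prod M N K) M fst) X =
      (\<integral>\<^sup>+z. indicator X (fst z) \<partial>kernel_prod M N K)"
    by (subst nn_integral_indicator[symmetric], simp, subst nn_integral_distr) auto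
  also have "\<dots> = (\<integral>\<^sup>+x. \<integral>\<^sup>+y. indicator X x \<partial>K x \<partial>M)"
    by (subst nn_integral_kernel_prod[OF K]) auto
  also have "\<dots> = (\<integral>\<^sup>+x. indicator X x \<partial>M)"
    by (intro nn_integral_cong)
      (simp add: prob_space.emeasure_space_1[OF prob_kernelD(1)[OF K]])
  finally show "emeasure (distr (kernel_prod M N K) M fst) X = emeasure M X" by simp
qed simp

section \<open>Square-integrable functions\<close>

definition L2 :: "'a measure \<Rightarrow> ('a \<Rightarrow> real) \<Rightarrow> bool" where
  "L2 M h \<longleftrightarrow> h \<in> borel_measurable M \<and> integrable M (\<lambda>x. (h x)\<^sup>2)"

lemma L2_integrable_mult:
  assumes "L2 M g" "L2 M h"
  shows "integrable M (\<lambda>x. g x * h x)"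
proof (rule Bochner_Integration.integrable_bound)
  show "integrable M (\<lambda>x. (g x)\<^sup>2 + (h x)\<^sup>2)"
    using assms by (auto simp: L2_def)
  have "\<bar>a * b\<bar> \<le> a\<^sup>2 + b\<^sup>2" for a b :: real
  proof -
    have "2 * (\<bar>a\<bar> * \<bar>b\<bar>) \<le> a\<^sup>2 + b\<^sup>2"
      using sum_squares_bound[of "\<bar>a\<bar>" "\<bar>b\<bar>"] by (simp add: mult.assoc)
    moreover have "0 \<le> a\<^sup>2 + b\<^sup>2" by simp
    ultimately show ?thesis unfolding abs_mult by linarith
  qed
  then show "AE x in M. norm (g x * h x) \<le> norm ((g x)\<^sup>2 + (h x)\<^sup>2)"
    by (auto intro!: AE_I2)
  show "(\<lambda>x. g x * h x) \<in> borel_measurable M"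
    using assms by (auto simp: L2_def)
qed

lemma L2_add:
  assumes "L2 M g" "L2 M h"
  shows "L2 M (\<lambda>x. g x + h x)"
proof -
  have "integrable M (\<lambda>x. (g x)\<^sup>2 + (h x)\<^sup>2 + 2 * (g x * h x))"
    using assms L2_integrable_mult[OF assms]
    by (intro Bochner_Integration.integrable_add integrable_mult_right) (simp_all add: L2_def)
  then show ?thesis
    using assms by (auto simp: L2_def power2_sum mult.assoc)
qed

lemma L2_cmult: "L2 M g \<Longrightarrow> L2 M (\<lambda>x. c * g x)"
  unfolding L2_def power_mult_distrib by auto

lemma L2_diff: "L2 M g \<Longrightarrow> L2 M h \<Longrightarrow> L2 M (\<lambda>x. g x - h x)"
  using L2_add[of M g "\<lambda>x. (-1) * h x"] L2_cmult[of M h "-1"] by simp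

lemma (in prob_space) L2_const: "L2 M (\<lambda>_. c)"
  by (simp add: L2_def)

lemma (in prob_space) L2_integrable: "L2 M h \<Longrightarrow> integrable M h"
  using square_integrable_imp_integrable[of h] unfolding L2_def by blast

lemma L2_distr:
  assumes "T \<in> M \<rightarrow>\<^sub>M N" "L2 (distr M N T) h"
  shows "L2 M (\<lambda>x. h (T x))"
  unfolding L2_def
proof
  show "(\<lambda>x. h (T x)) \<in> borel_measurable M"
    using assms by (intro measurable_compose[OF assms(1)]) (simp add: L2_def)
  show "integrable M (\<lambda>x. (h (T x))\<^sup>2)"
    using assms(2) by (intro integrable_distr[OF assms(1)]) (simp add: L2_def)
qed

text \<open>The variance is nonnegative; this is Jensen's inequality for the square.\<close>

lemma (in prob_space) square_integral_le:
  fixes h :: "'a \<Rightarrow> real"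
  assumes "L2 M h"
  shows "(\<integral>x. h x \<partial>M)\<^sup>2 \<le> (\<integral>x. (h x)\<^sup>2 \<partial>M)"
proof -
  have "0 \<le> (\<integral>x. (h x - expectation h)\<^sup>2 \<partial>M)" by simp
  then show ?thesis
    using variance_eq[OF L2_integrable[OF assms]] assms unfolding L2_def by linarith
qed

text \<open>By Jensen under each probability measure \<open>K x\<close>, averaging over the second
  coordinate does not increase the second moment.\<close>

lemma kernel_integral_L2:
  assumes K: "K \<in> M \<rightarrow>\<^sub>M prob_algebra N" and M: "prob_space M" and h: "L2 (kernel_prod M N K) h"
  shows "L2 M (\<lambda>x. \<integral>y. h (x, y) \<partial>K x)"
proof -
  interpret prob_space M by fact
  have h': "h \<in> borel_measurable (M \<Otimes>\<^sub>M N)" "integrable (kernel_prod M N K) (\<lambda>z. (h z)\<^sup>2)"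
    using h measurable_cong_sets[OF sets_kernel_prod[OF K not_empty], of borel borel]
    unfolding L2_def by auto
  have m[measurable]: "(\<lambda>x. \<integral>y. h (x, y) \<partial>K x) \<in> borel_measurable M"
    by (rule measurable_kernel_integral[OF K h'(1)])
  have "AE x in M. (\<integral>y. h (x, y) \<partial>K x)\<^sup>2 \<le> (\<integral>y. (h (x, y))\<^sup>2 \<partial>K x)"
    using AE_integrable_kernel[OF K not_empty h'(2)] AE_space
    by eventually_elim
      (simp add: prob_space.square_integral_le prob_kernelD(1)[OF K] L2_def
        measurable_compose[OF measurable_Pair_kernel[OF K] h'(1)])
  then have "AE x in M. norm ((\<integral>y. h (x, y) \<partial>K x)\<^sup>2) \<le> norm (\<integral>y. (h (x, y))\<^sup>2 \<partial>K x)"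
    by eventually_elim simp
  then have "integrable M (\<lambda>x. (\<integral>y. h (x, y) \<partial>K x)\<^sup>2)"
    by (intro Bochner_Integration.integrable_bound[OF integrable_kernel_integral[OF K not_empty h'(2)]]) auto
  then show ?thesis by (simp add: L2_def)
qed

section \<open>Measurability in the space of finite subsets\<close>

lemma listset_replicate: "listset (replicate n X) = {xs. length xs = n \<and> set xs \<subseteq> X}"
proof (induction n)
  case (Suc n)
  show ?case
    by (auto simp: Suc set_Cons_def length_Suc_conv)
qed auto

lemma listset_in_tuple_space:
  assumes "As \<noteq> []" "set As \<subseteq> sets M"
  shows "listset As \<in> sets (tuple_space M)"
proof -
  \<comment> \<open>The generators must be subsets of the space: the entries of a list in a box come
    from its factors, and equal lengths keep the list nonempty.\<close>
  have "set xs \<subseteq> \<Union>(set Bs) \<and> length xs = length Bs" if "xs \<in> listset Bs" for xs :: "'a list" and Bs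
    using that by (induction Bs arbitrary: xs) (fastforce simp: set_Cons_def)+
  moreover have "\<Union>(set Bs) \<subseteq> space M" if "set Bs \<subseteq> sets M" for Bs
    using that sets.sets_into_space by blast
  ultimately have "{listset Bs |Bs. Bs \<noteq> [] \<and> set Bs \<subseteq> sets M} \<subseteq> Pow {xs. xs \<noteq> [] \<and> set xs \<subseteq> space M}"
    by fastforce
  then show ?thesis
    unfolding tuple_space_def using assms by (rule_tac in_measure_of) auto
qed

text \<open>The preimage under \<open>set\<close> is the countable union, over lengths at least 1,
  of the powers of \<open>space M - {x}\<close>. This makes membership of a fixed point a measurable
  event.\<close>

lemma avoid_point_measurable:
  assumes "{x} \<in> sets M"
  shows "{A \<in> space (finset_space M). x \<notin> A} \<in> sets (finset_space M)"
proof -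
  have "set -` {A \<in> space (finset_space M). x \<notin> A} \<inter> space (tuple_space M) =
      (\<Union>n. listset (replicate (Suc n) (space M - {x})))"
    unfolding listset_replicate space_finset_space space_tuple_space
    by (auto simp: length_Suc_conv neq_Nil_conv)
  also have "\<dots> \<in> sets (tuple_space M)"
    using assms by (intro sets.countable_UN) (auto intro!: listset_in_tuple_space simp del: listset.simps)
  finally show ?thesis
    unfolding sets_finset_space by (auto simp: space_finset_space)
qed

text \<open>The Boltzmann case is encoded by \<open>\<kappa>_const\<close>: the selection law does
  not depend on which element of \<open>A\<close> is the current state.
  \<open>boltzmann_kernel_const\<close> derives this from the weights.\<close>

locale boltzmann_selection = prob_space \<pi> for \<pi> :: "'a measure" +
  fixes Q :: "'a \<Rightarrow> 'a set measure" and \<kappa> :: "'a \<Rightarrow> 'a set \<Rightarrow> 'a measure"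
  assumes singleton_sets: "x \<in> space \<pi> \<Longrightarrow> {x} \<in> sets \<pi>"
    and Q: "proposition_kernel \<pi> Q"
    and \<kappa>: "selection_kernel \<pi> Q \<kappa>"
    and \<kappa>_const: "A \<in> space (finset_space \<pi>) \<Longrightarrow> x \<in> A \<Longrightarrow> y \<in> A \<Longrightarrow> \<kappa> x A = \<kappa> y A"
begin

section \<open>The triple law, its marginals and its reversal\<close>

abbreviation "S \<equiv> finset_space \<pi>"
abbreviation "N \<equiv> proposal_law \<pi> Q"
abbreviation "T \<equiv> triple_law \<pi> Q \<kappa>"
abbreviation "P \<equiv> transition_kernel Q \<kappa>"

lemma Q_kernel: "Q \<in> \<pi> \<rightarrow>\<^sub>M prob_algebra S"
  using Q by (simp add: proposition_kernel_def)

lemma sets_N[measurable_cong]: "sets N = sets (\<pi> \<Otimes>\<^sub>M S)"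
  unfolding proposal_law_def by (rule sets_kernel_prod[OF Q_kernel not_empty])

lemma prob_space_N: "prob_space N"
  unfolding proposal_law_def by (rule prob_space_kernel_prod[OF prob_space_axioms Q_kernel])

lemma \<kappa>_kernel: "(\<lambda>(x, A). \<kappa> x A) \<in> \<pi> \<Otimes>\<^sub>M S \<rightarrow>\<^sub>M prob_algebra \<pi>"
  using \<kappa> by (simp add: selection_kernel_def)

lemma \<kappa>_kernel_N: "(\<lambda>(x, A). \<kappa> x A) \<in> N \<rightarrow>\<^sub>M prob_algebra \<pi>"
  using \<kappa>_kernel measurable_cong_sets[OF sets_N refl] by blast

lemma \<kappa>_kernel_at:
  assumes "x \<in> space \<pi>"
  shows "\<kappa> x \<in> S \<rightarrow>\<^sub>M prob_algebra \<pi>"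
  using measurable_compose[OF measurable_Pair1'[OF assms] \<kappa>_kernel] by simp

lemma \<kappa>_kernel_Q:
  assumes "x \<in> space \<pi>"
  shows "\<kappa> x \<in> Q x \<rightarrow>\<^sub>M prob_algebra \<pi>"
  using \<kappa>_kernel_at[OF assms] measurable_cong_sets[OF prob_kernelD(2)[OF Q_kernel assms] refl] by blast

lemma prob_space_\<kappa>:
  assumes "x \<in> space \<pi>" "A \<in> space S"
  shows "prob_space (\<kappa> x A)"
  by (rule prob_kernelD(1)[OF \<kappa>_kernel_at[OF assms(1)] assms(2)])

lemma P_kernel: "P \<in> \<pi> \<rightarrow>\<^sub>M prob_algebra \<pi>"
  unfolding transition_kernel_def[abs_def]
  by (rule measurable_bind_prob_space2[OF Q_kernel \<kappa>_kernel])

lemma sets_T: "sets T = sets ((\<pi> \<Otimes>\<^sub>M S) \<Otimes>\<^sub>M \<pi>)"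
  unfolding triple_law_def
  by (subst sets_kernel_prod[OF \<kappa>_kernel_N prob_space.not_empty[OF prob_space_N]])
    (intro sets_pair_measure_cong sets_N refl)

lemma measurable_T: "(g \<in> T \<rightarrow>\<^sub>M L) \<longleftrightarrow> (g \<in> (\<pi> \<Otimes>\<^sub>M S) \<Otimes>\<^sub>M \<pi> \<rightarrow>\<^sub>M L)"
  using measurable_cong_sets[OF sets_T refl] by blast

lemma measurable_N: "(g \<in> N \<rightarrow>\<^sub>M L) \<longleftrightarrow> (g \<in> \<pi> \<Otimes>\<^sub>M S \<rightarrow>\<^sub>M L)"
  using measurable_cong_sets[OF sets_N refl] by blast

lemma measurable_fst_T: "fst \<in> T \<rightarrow>\<^sub>M N"
  by (simp add: measurable_T measurable_cong_sets[OF refl sets_N])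

lemma measurable_state_T: "(\<lambda>z. fst (fst z)) \<in> T \<rightarrow>\<^sub>M \<pi>"
  by (simp add: measurable_T)

lemma measurable_snd_T: "snd \<in> T \<rightarrow>\<^sub>M \<pi>"
  by (simp add: measurable_T)

lemma measurable_swap_T: "(\<lambda>((x, A), y). ((y, A), x)) \<in> T \<rightarrow>\<^sub>M T"
  unfolding measurable_T measurable_cong_sets[OF refl sets_T] case_prod_beta by measurable

lemma distr_swap_T: "distr T T (\<lambda>((x, A), y). ((y, A), x)) = T"
  using \<kappa> by (simp add: selection_kernel_def)

lemma distr_fst_T: "distr T N fst = N"
  unfolding triple_law_def
  by (rule distr_fst_kernel_prod[OF \<kappa>_kernel_N prob_space.not_empty[OF prob_space_N]])

lemma distr_fst_N: "distr N \<pi> fst = \<pi>"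
  unfolding proposal_law_def by (rule distr_fst_kernel_prod[OF Q_kernel not_empty])

lemma distr_state_T: "distr T \<pi> (\<lambda>z. fst (fst z)) = \<pi>"
proof -
  have "distr (distr T N fst) \<pi> fst = distr T \<pi> (\<lambda>z. fst (fst z))"
    by (subst distr_distr) (simp_all add: measurable_N measurable_fst_T comp_def)
  then show ?thesis by (simp add: distr_fst_T distr_fst_N)
qed

text \<open>Stationarity from reversibility: exchanging the two states preserves the triple law, so
  both have the same marginal.\<close>

lemma distr_snd_T: "distr T \<pi> snd = \<pi>"
proof -
  have "distr (distr T T (\<lambda>((x, A), y). ((y, A), x))) \<pi> snd = distr T \<pi> (\<lambda>z. fst (fst z))"
    by (subst distr_distr[OF measurable_snd_T measurable_swap_T]) (simp add: comp_def case_prod_beta)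
  then show ?thesis by (simp add: distr_swap_T distr_state_T)
qed

lemma nn_integral_P:
  assumes "x \<in> space \<pi>" "h \<in> borel_measurable \<pi>"
  shows "(\<integral>\<^sup>+y. h y \<partial>P x) = (\<integral>\<^sup>+A. \<integral>\<^sup>+y. h y \<partial>\<kappa> x A \<partial>Q x)"
  unfolding transition_kernel_def
  by (rule nn_integral_bind[OF assms(2) measurable_prob_algebraD[OF \<kappa>_kernel_Q[OF assms(1)]]])

text \<open>Integrating out the proposed set composes \<open>Q\<close> with \<open>\<kappa>\<close>
  into \<open>P\<close>. Integrals against \<open>P\<close> can then be computed under
  \<open>T\<close>, where the reversal is available.\<close>

lemma distr_states_T: "distr T (\<pi> \<Otimes>\<^sub>M \<pi>) (\<lambda>z. (fst (fst z), snd z)) = kernel_prod \<pi> \<pi> P"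
proof (rule measure_eqI)
  show "sets (distr T (\<pi> \<Otimes>\<^sub>M \<pi>) (\<lambda>z. (fst (fst z), snd z))) = sets (kernel_prod \<pi> \<pi> P)"
    by (simp add: sets_kernel_prod[OF P_kernel not_empty])
  fix D assume "D \<in> sets (distr T (\<pi> \<Otimes>\<^sub>M \<pi>) (\<lambda>z. (fst (fst z), snd z)))"
  then have D[measurable]: "D \<in> sets (\<pi> \<Otimes>\<^sub>M \<pi>)" by simp
  have DN: "(\<lambda>z. indicator D (fst (fst z), snd z)) \<in> borel_measurable (N \<Otimes>\<^sub>M \<pi>)" 
    by measurable
  have m: "(\<lambda>z. (fst (fst z), snd z)) \<in> T \<rightarrow>\<^sub>M \<pi> \<Otimes>\<^sub>M \<pi>"
    unfolding measurable_T by measurable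
  have "emeasure (distr T (\<pi> \<Otimes>\<^sub>M \<pi>) (\<lambda>z. (fst (fst z), snd z))) D =
      (\<integral>\<^sup>+z. indicator D (fst (fst z), snd z) \<partial>T)"
    by (subst nn_integral_indicator[symmetric], simp, subst nn_integral_distr[OF m]) auto
  also have "\<dots> = (\<integral>\<^sup>+z. \<integral>\<^sup>+y. indicator D (fst z, y) \<partial>\<kappa> (fst z) (snd z) \<partial>N)"
    unfolding triple_law_def
    by (subst nn_integral_kernel_prod[OF \<kappa>_kernel_N DN]) (simp add: case_prod_beta)
  also have "\<dots> = (\<integral>\<^sup>+x. \<integral>\<^sup>+A. \<integral>\<^sup>+y. indicator D (x, y) \<partial>\<kappa> x A \<partial>Q x \<partial>\<pi>)"
    unfolding proposal_law_def
  proof (subst nn_integral_kernel_prod[OF Q_kernel])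
    have "(\<lambda>w. indicator D (fst (fst w), snd w)) \<in> borel_measurable ((\<pi> \<Otimes>\<^sub>M S) \<Otimes>\<^sub>M \<pi>)"
      by measurable
    from measurable_kernel_nn_integral[OF \<kappa>_kernel this]
    show "(\<lambda>z. \<integral>\<^sup>+y. indicator D (fst z, y) \<partial>\<kappa> (fst z) (snd z)) \<in> borel_measurable (\<pi> \<Otimes>\<^sub>M S)"
      by (simp add: case_prod_beta)
  qed simp
  also have "\<dots> = (\<integral>\<^sup>+x. \<integral>\<^sup>+y. indicator D (x, y) \<partial>P x \<partial>\<pi>)"
    by (intro nn_integral_cong nn_integral_P[symmetric]) simp_all
  also have "\<dots> = emeasure (kernel_prod \<pi> \<pi> P) D"
    by (subst nn_integral_indicator[symmetric], simp add: sets_kernel_prod[OF P_kernel not_empty],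
        subst nn_integral_kernel_prod[OF P_kernel]) auto
  finally show "emeasure (distr T (\<pi> \<Otimes>\<^sub>M \<pi>) (\<lambda>z. (fst (fst z), snd z))) D =
    emeasure (kernel_prod \<pi> \<pi> P) D" .
qed

section \<open>Functions of the two states and their correlation\<close>

lemma L2_state: "L2 \<pi> h \<Longrightarrow> L2 T (\<lambda>z. h (fst (fst z)))"
  by (rule L2_distr[OF measurable_state_T]) (simp add: distr_state_T)

lemma L2_next: "L2 \<pi> h \<Longrightarrow> L2 T (\<lambda>z. h (snd z))"
  by (rule L2_distr[OF measurable_snd_T]) (simp add: distr_snd_T)

lemma integral_state: "h \<in> borel_measurable \<pi> \<Longrightarrow> (\<integral>z. h (fst (fst z)) \<partial>T) = (\<integral>x. h x \<partial>\<pi>)" for h :: "'a \<Rightarrow> real"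
  using integral_distr[OF measurable_state_T, of h] by (simp add: distr_state_T)

lemma integral_next: "h \<in> borel_measurable \<pi> \<Longrightarrow> (\<integral>z. h (snd z) \<partial>T) = (\<integral>x. h x \<partial>\<pi>)" for h :: "'a \<Rightarrow> real"
  using integral_distr[OF measurable_snd_T, of h] by (simp add: distr_snd_T)

lemma integral_swap:
  fixes g :: "_ \<Rightarrow> real"
  assumes "g \<in> borel_measurable T"
  shows "(\<integral>z. g ((snd z, snd (fst z)), fst (fst z)) \<partial>T) = (\<integral>z. g z \<partial>T)"
  using integral_distr[OF measurable_swap_T assms] by (simp add: distr_swap_T case_prod_beta)

lemma integral_kernel_prod_P:
  fixes g :: "_ \<Rightarrow> real"
  assumes "g \<in> borel_measurable (\<pi> \<Otimes>\<^sub>M \<pi>)"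
  shows "(\<integral>z. g z \<partial>kernel_prod \<pi> \<pi> P) = (\<integral>z. g (fst (fst z), snd z) \<partial>T)"
proof -
  have m: "(\<lambda>z. (fst (fst z), snd z)) \<in> T \<rightarrow>\<^sub>M \<pi> \<Otimes>\<^sub>M \<pi>"
    unfolding measurable_T by measurable
  show ?thesis unfolding distr_states_T[symmetric] by (rule integral_distr[OF m assms])
qed

text \<open>The bilinear form \<open>\<langle>\<pi>, g Ph\<rangle>\<close> (see
  \<open>corr_kernel_op\<close>), written over the triple law so that both the exchange of states
  and conditioning on \<open>(x, A)\<close> apply to it.\<close>

definition corr :: "('a \<Rightarrow> real) \<Rightarrow> ('a \<Rightarrow> real) \<Rightarrow> real" where
  "corr g h = (\<integral>z. g (fst (fst z)) * h (snd z) \<partial>T)"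

lemma integrable_corr:
  "L2 \<pi> g \<Longrightarrow> L2 \<pi> h \<Longrightarrow> integrable T (\<lambda>z. g (fst (fst z)) * h (snd z))"
  by (rule L2_integrable_mult[OF L2_state L2_next])

text \<open>Exchanging the states swaps the factors; this is self-adjointness of
  \<open>P\<close>.\<close>

lemma corr_sym:
  assumes "L2 \<pi> g" "L2 \<pi> h"
  shows "corr g h = corr h g"
  using integral_swap[OF borel_measurable_integrable[OF integrable_corr[OF assms]]]
  by (simp add: corr_def mult.commute)

lemma corr_diff_left:
  assumes "L2 \<pi> g" "L2 \<pi> g'" "L2 \<pi> h"
  shows "corr (\<lambda>x. g x - g' x) h = corr g h - corr g' h"
  unfolding corr_def using assms by (simp add: left_diff_distrib integrable_corr)

lemma corr_cmult_left: "corr (\<lambda>x. c * g x) h = c * corr g h"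
  unfolding corr_def by (simp add: mult.assoc)

lemma corr_diff_right:
  assumes "L2 \<pi> g" "L2 \<pi> g'" "L2 \<pi> h"
  shows "corr h (\<lambda>x. g x - g' x) = corr h g - corr h g'"
  unfolding corr_def using assms by (simp add: right_diff_distrib integrable_corr)

lemma corr_cmult_right: "corr h (\<lambda>x. c * g x) = c * corr h g"
  unfolding corr_def by (simp add: mult.left_commute)

lemma
  assumes "L2 \<pi> g" "L2 \<pi> h"
  shows corr_kernel_op: "corr g h = (\<integral>x. g x * kernel_op P h x \<partial>\<pi>)"
    and integrable_kernel_op: "integrable \<pi> (\<lambda>x. g x * kernel_op P h x)"
proof -
  have m: "(\<lambda>z. (fst (fst z), snd z)) \<in> T \<rightarrow>\<^sub>M \<pi> \<Otimes>\<^sub>M \<pi>"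
    unfolding measurable_T by measurable
  have [measurable]: "g \<in> borel_measurable \<pi>" "h \<in> borel_measurable \<pi>"
    using assms by (auto simp: L2_def)
  have gh: "(\<lambda>z. g (fst z) * h (snd z)) \<in> borel_measurable (\<pi> \<Otimes>\<^sub>M \<pi>)"
    by measurable
  have "integrable (kernel_prod \<pi> \<pi> P) (\<lambda>z. g (fst z) * h (snd z))"
    unfolding distr_states_T[symmetric] integrable_distr_eq[OF m gh]
    using integrable_corr[OF assms] by simp
  from integrable_kernel_integral[OF P_kernel not_empty this]
    integral_kernel_prod[OF P_kernel not_empty this] integral_kernel_prod_P[OF gh]
  show "corr g h = (\<integral>x. g x * kernel_op P h x \<partial>\<pi>)" "integrable \<pi> (\<lambda>x. g x * kernel_op P h x)"
    by (simp_all add: corr_def kernel_op_def)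
qed

section \<open>Averages over the selection kernel and the mean conditional variance\<close>

definition sel :: "('a \<Rightarrow> real) \<Rightarrow> 'a \<times> 'a set \<Rightarrow> real" where
  "sel h = (\<lambda>(x, A). \<integral>y. h y \<partial>\<kappa> x A)"

lemma measurable_sel:
  assumes [measurable]: "h \<in> borel_measurable \<pi>"
  shows "sel h \<in> borel_measurable (\<pi> \<Otimes>\<^sub>M S)"
proof -
  have "(\<lambda>z. h (snd z)) \<in> borel_measurable ((\<pi> \<Otimes>\<^sub>M S) \<Otimes>\<^sub>M \<pi>)" by measurable
  from measurable_kernel_integral[OF \<kappa>_kernel this] show ?thesis
    by (simp add: sel_def case_prod_beta)
qed

lemma L2_sel: "L2 \<pi> h \<Longrightarrow> L2 N (sel h)"
  using kernel_integral_L2[OF \<kappa>_kernel_N prob_space_N L2_next[unfolded triple_law_def]]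
  by (simp add: sel_def case_prod_beta')

text \<open>The proposition kernel integrates an indicator over all sets avoiding \<open>x\<close>;
  cut down to \<open>space S\<close> this event is measurable by
  \<open>avoid_point_measurable\<close>, hence null.\<close>

lemma AE_Q_mem:
  assumes x: "x \<in> space \<pi>"
  shows "AE A in Q x. x \<in> A"
proof -
  have sp: "space (Q x) = space S" and st: "sets (Q x) = sets S"
    using prob_kernelD[OF Q_kernel x] by auto
  have B: "{A \<in> space S. x \<notin> A} \<in> sets (Q x)"
    unfolding st by (rule avoid_point_measurable[OF singleton_sets[OF x]])
  have "emeasure (Q x) {A \<in> space S. x \<notin> A} = (\<integral>\<^sup>+A. indicator {A. x \<notin> A} A \<partial>Q x)"
    by (subst nn_integral_indicator[OF B, symmetric])
      (auto intro!: nn_integral_cong simp: sp split: split_indicator)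
  also have "\<dots> = 0"
    using Q x by (simp add: proposition_kernel_def)
  finally have "{A \<in> space S. x \<notin> A} \<in> null_sets (Q x)"
    using B by auto
  from AE_not_in[OF this] AE_space[of "Q x"] show ?thesis
    by eventually_elim (auto simp: sp)
qed

lemma AE_\<kappa>_mem:
  assumes "A \<in> space S" "x \<in> A"
  shows "AE y in \<kappa> x A. y \<in> A"
proof -
  have "x \<in> space \<pi>" using assms by (auto simp: space_finset_space)
  from prob_space_\<kappa>[OF this assms(1)] interpret K: prob_space "\<kappa> x A" .
  have "measure (\<kappa> x A) A = 1"
    using \<kappa> assms by (simp add: selection_kernel_def)
  then show ?thesis by (rule K.AE_prob_1)
qed

text \<open>The diagonal of \<open>E \<times> E\<close> need not be measurable, so \<open>x \<in> A\<close> is used only under \<open>Q x\<close>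
  for a fixed \<open>x\<close>, after an iterated integration.\<close>

lemma AE_sel_eq:
  assumes h: "h \<in> borel_measurable \<pi>"
  shows "AE z in T. sel h (fst z) = sel h (snd z, snd (fst z))"
proof -
  note [measurable] = measurable_sel[OF h]
  \<comment> \<open>\<open>\<phi>\<close> marks the failure of the equality. It is jointly
    measurable because \<open>sel h\<close> is, so its integral can be iterated, with
    \<open>x\<close> fixed outermost.\<close>
  define \<phi> :: "('a \<times> 'a set) \<times> 'a \<Rightarrow> ennreal" where
    "\<phi> z = (if sel h (fst z) = sel h (snd z, snd (fst z)) then 0 else 1)" for z
  have \<phi>[measurable]: "\<phi> \<in> borel_measurable ((\<pi> \<Otimes>\<^sub>M S) \<Otimes>\<^sub>M \<pi>)"
    unfolding \<phi>_def by measurable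
  have \<phi>N: "\<phi> \<in> borel_measurable (N \<Otimes>\<^sub>M \<pi>)" by measurable
  have "(\<integral>\<^sup>+z. \<phi> z \<partial>T) = (\<integral>\<^sup>+z. \<integral>\<^sup>+y. \<phi> (z, y) \<partial>\<kappa> (fst z) (snd z) \<partial>N)"
    unfolding triple_law_def
    by (subst nn_integral_kernel_prod[OF \<kappa>_kernel_N \<phi>N]) (simp add: case_prod_beta)
  also have "\<dots> = (\<integral>\<^sup>+x. \<integral>\<^sup>+A. \<integral>\<^sup>+y. \<phi> ((x, A), y) \<partial>\<kappa> x A \<partial>Q x \<partial>\<pi>)"
    unfolding proposal_law_def
    using measurable_kernel_nn_integral[OF \<kappa>_kernel \<phi>]
    by (subst nn_integral_kernel_prod[OF Q_kernel]) (simp_all add: case_prod_beta)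
  also have "\<dots> = (\<integral>\<^sup>+x. 0 \<partial>\<pi>)"
  proof (rule nn_integral_cong)
    fix x assume x: "x \<in> space \<pi>"
    have "AE A in Q x. (\<integral>\<^sup>+y. \<phi> ((x, A), y) \<partial>\<kappa> x A) = 0"
      using AE_Q_mem[OF x] AE_space
    proof eventually_elim
      case (elim A)
      then have A: "A \<in> space S" using prob_kernelD(3)[OF Q_kernel x] by simp
      \<comment> \<open>Both \<open>x\<close> and almost every \<open>y\<close> lie in
        \<open>A\<close>, so \<open>\<kappa>_const\<close> identifies the two selection
        laws.\<close>
      have "AE y in \<kappa> x A. \<phi> ((x, A), y) = 0"
        using AE_\<kappa>_mem[OF A elim(1)]
        by eventually_elim (use \<kappa>_const[OF A elim(1)] in \<open>simp add: \<phi>_def sel_def\<close>)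
      then show ?case by (simp cong: nn_integral_cong_AE)
    qed
    then show "(\<integral>\<^sup>+A. \<integral>\<^sup>+y. \<phi> ((x, A), y) \<partial>\<kappa> x A \<partial>Q x) = 0"
      by (simp cong: nn_integral_cong_AE)
  qed
  finally have "(\<integral>\<^sup>+z. \<phi> z \<partial>T) = 0" by simp
  then have "AE z in T. \<phi> z = 0"
    by (subst (asm) nn_integral_0_iff_AE) (simp_all add: measurable_T)
  then show ?thesis
    by eventually_elim (simp add: \<phi>_def split: if_splits)
qed

text \<open>Conditioning on \<open>(x, A)\<close> replaces \<open>h\<close> at the next state by
  \<open>sel h\<close>. That average is the same seen from either state, so after the exchange of
  states \<open>g\<close> sits at the next state and is averaged in turn.\<close>

lemma corr_sel:
  assumes g: "L2 \<pi> g" and h: "L2 \<pi> h"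
  shows "corr g h = (\<integral>z. sel g z * sel h z \<partial>N)"
proof -
  have [measurable]: "g \<in> borel_measurable \<pi>" "h \<in> borel_measurable \<pi>"
    using g h by (auto simp: L2_def)
  note [measurable] = measurable_sel[of g] measurable_sel[of h]
  note ne = prob_space.not_empty[OF prob_space_N]
  have i: "integrable T (\<lambda>z. g (fst (fst z)) * h (snd z))"
    by (rule integrable_corr[OF g h])
  have L: "L2 T (\<lambda>z. sel h (fst z))"
    by (rule L2_distr[OF measurable_fst_T]) (simp add: distr_fst_T L2_sel h)
  have j: "integrable T (\<lambda>z. g (snd z) * sel h (fst z))"
    by (rule L2_integrable_mult[OF L2_next[OF g] L])
  have mT: "(\<lambda>z. g (fst (fst z)) * sel h (fst z)) \<in> borel_measurable T"
    "(\<lambda>z. g (fst (fst z)) * sel h (snd z, snd (fst z))) \<in> borel_measurable T"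
    unfolding measurable_T by measurable
  have "corr g h = (\<integral>z. g (fst z) * sel h z \<partial>N)"
    using integral_kernel_prod[OF \<kappa>_kernel_N ne i[unfolded triple_law_def]]
    by (simp add: corr_def triple_law_def sel_def case_prod_beta)
  also have "\<dots> = (\<integral>z. g (fst (fst z)) * sel h (fst z) \<partial>T)"
    using integral_distr[OF measurable_fst_T, of "\<lambda>z. g (fst z) * sel h z"]
    by (simp add: distr_fst_T measurable_N)
  \<comment> \<open>The argument of \<open>sel h\<close> is moved to the next state, so that the
    exchange brings it back to the current one and carries \<open>g\<close> to the next.\<close>
  also have "\<dots> = (\<integral>z. g (fst (fst z)) * sel h (snd z, snd (fst z)) \<partial>T)"
    using AE_sel_eq[of h] by (intro integral_cong_AE mT) auto
  also have "\<dots> = (\<integral>z. g (snd z) * sel h (fst z) \<partial>T)"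
    using integral_swap[OF borel_measurable_integrable[OF j]] by simp
  also have "\<dots> = (\<integral>z. sel g z * sel h z \<partial>N)"
    using integral_kernel_prod[OF \<kappa>_kernel_N ne j[unfolded triple_law_def]]
    by (simp add: triple_law_def sel_def case_prod_beta)
  finally show ?thesis .
qed

text \<open>The averages of \<open>h\<^sup>2\<close> integrate to its \<open>\<pi>\<close>-mean by
  stationarity, and the squared averages of \<open>h\<close> to \<open>corr h h\<close> by
  \<open>corr_sel\<close>.\<close>

lemma
  assumes h: "L2 \<pi> h"
  shows integrable_variance_sel: "integrable N (\<lambda>(x, A). variance_of (\<kappa> x A) h)"
    and integral_variance_sel:
      "(\<integral>(x, A). variance_of (\<kappa> x A) h \<partial>N) = (\<integral>x. (h x)\<^sup>2 \<partial>\<pi>) - corr h h"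
proof -
  have [measurable]: "h \<in> borel_measurable \<pi>" using h by (auto simp: L2_def)
  note ne = prob_space.not_empty[OF prob_space_N]
  have i: "integrable T (\<lambda>z. (h (snd z))\<^sup>2)"
    using L2_next[OF h] by (simp add: L2_def)
  have a: "integrable N (\<lambda>z. sel (\<lambda>y. (h y)\<^sup>2) z)"
    using integrable_kernel_integral[OF \<kappa>_kernel_N ne i[unfolded triple_law_def]]
    by (simp add: sel_def case_prod_beta)
  have b: "(\<integral>z. sel (\<lambda>y. (h y)\<^sup>2) z \<partial>N) = (\<integral>x. (h x)\<^sup>2 \<partial>\<pi>)"
    using integral_kernel_prod[OF \<kappa>_kernel_N ne i[unfolded triple_law_def]]
      integral_next[of "\<lambda>x. (h x)\<^sup>2"]
    by (simp add: sel_def case_prod_beta triple_law_def)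
  have c: "integrable N (\<lambda>z. sel h z * sel h z)"
    by (intro L2_integrable_mult L2_sel h)
  have e: "(\<lambda>(x, A). variance_of (\<kappa> x A) h) = (\<lambda>z. sel (\<lambda>y. (h y)\<^sup>2) z - sel h z * sel h z)"
    by (auto simp: variance_of_def sel_def power2_eq_square)
  show "integrable N (\<lambda>(x, A). variance_of (\<kappa> x A) h)"
    unfolding e using a c by simp
  show "(\<integral>(x, A). variance_of (\<kappa> x A) h \<partial>N) = (\<integral>x. (h x)\<^sup>2 \<partial>\<pi>) - corr h h"
    unfolding e using a b c corr_sel[OF h h] by simp
qed

text \<open>Expand the square: both states have law \<pi>, and the cross term is
  \<open>corr h h\<close>. The minus sign gives the Dirichlet form, the plus sign the quantity
  behind \<open>Delta\<close>.\<close>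

lemma dirichlet_form:
  assumes h: "L2 \<pi> h"
  shows "(\<integral>x. (h x)\<^sup>2 \<partial>\<pi>) - corr h h = 1 / 2 * (\<integral>z. (h (fst (fst z)) - h (snd z))\<^sup>2 \<partial>T)"
    and "(\<integral>x. (h x)\<^sup>2 \<partial>\<pi>) + corr h h = 1 / 2 * (\<integral>z. (h (fst (fst z)) + h (snd z))\<^sup>2 \<partial>T)"
proof -
  have [measurable]: "h \<in> borel_measurable \<pi>" using h by (auto simp: L2_def)
  have i: "integrable T (\<lambda>z. (h (fst (fst z)))\<^sup>2)" "integrable T (\<lambda>z. (h (snd z))\<^sup>2)"
    "integrable T (\<lambda>z. h (fst (fst z)) * h (snd z))"
    using L2_state[OF h] L2_next[OF h] integrable_corr[OF h h] by (auto simp: L2_def)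
  have v: "(\<integral>z. (h (fst (fst z)))\<^sup>2 \<partial>T) = (\<integral>x. (h x)\<^sup>2 \<partial>\<pi>)"
      "(\<integral>z. (h (snd z))\<^sup>2 \<partial>T) = (\<integral>x. (h x)\<^sup>2 \<partial>\<pi>)"
    using integral_state[of "\<lambda>x. (h x)\<^sup>2"] integral_next[of "\<lambda>x. (h x)\<^sup>2"] by simp_all
  show "(\<integral>x. (h x)\<^sup>2 \<partial>\<pi>) - corr h h = 1 / 2 * (\<integral>z. (h (fst (fst z)) - h (snd z))\<^sup>2 \<partial>T)"
    unfolding power2_diff corr_def using i v by (simp add: mult.assoc)
  show "(\<integral>x. (h x)\<^sup>2 \<partial>\<pi>) + corr h h = 1 / 2 * (\<integral>z. (h (fst (fst z)) + h (snd z))\<^sup>2 \<partial>T)"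
    unfolding power2_sum corr_def using i v by (simp add: mult.assoc)
qed

section \<open>The law of the first two states of the stationary chain\<close>

lemma distr_chain_law:
  "distr (chain_law \<pi> Q \<kappa> \<pi>) (\<pi> \<Otimes>\<^sub>M \<pi>) (\<lambda>\<omega>. (snd (\<omega> 0), snd (\<omega> 1))) = kernel_prod \<pi> \<pi> P"
  (is "distr ?L _ ?\<phi> = _")
proof -
  let ?K = "chain_kernel \<pi> Q \<kappa> \<pi>" and ?M = "\<lambda>_::nat. S \<Otimes>\<^sub>M \<pi>" and ?J = "{0..<2::nat}"
  let ?u = "\<lambda>_::nat. undefined :: 'a set \<times> 'a" and ?k = "\<lambda>x. kernel_prod (Q x) \<pi> (\<kappa> x)"
  interpret IT: Ionescu_Tulcea ?K ?M
    by (rule Ionescu_Tulcea_chain[OF Q \<kappa> prob_space_axioms refl])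
  \<comment> \<open>The empty product has a single point, the constant \<open>undefined\<close>; the
    construction starts there.\<close>
  have u: "?u \<in> space (PiM {0..<0} ?M)" by (simp add: space_PiM)
  have L: "?L = IT.PF.lim" by (simp add: chain_law_def)
  have \<phi>[measurable]: "?\<phi> \<in> PiM ?J ?M \<rightarrow>\<^sub>M \<pi> \<Otimes>\<^sub>M \<pi>" by measurable
  have r: "(\<lambda>\<omega>. restrict \<omega> ?J) \<in> IT.PF.lim \<rightarrow>\<^sub>M PiM ?J ?M"
    unfolding measurable_cong_sets[OF IT.PF.sets_lim refl]
    by (rule measurable_restrict_subset) simp
  \<comment> \<open>\<open>IT.C 0 2\<close> appends coordinates 0 and 1. Its recursion begins with
    the point mass at \<open>?u\<close>, which \<open>bind_return\<close> absorbs.\<close>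
  have C2: "IT.C 0 2 ?u = IT.eP 0 ?u \<bind> IT.eP 1"
    using bind_return[OF IT.measurable_eP u] by (simp add: numeral_2_eq_2)
  have CI: "IT.CI ?J = IT.C 0 2 ?u"
  proof (rule measure_eqI)
    show "sets (IT.CI ?J) = sets (IT.C 0 2 ?u)"
      using IT.sets_C[OF u, of 2] by (simp add: IT.CI_def numeral_2_eq_2)
    fix X assume "X \<in> sets (IT.CI ?J)"
    then have X: "X \<in> sets (PiM ?J ?M)" by (simp add: IT.CI_def)
    \<comment> \<open>The index set is all of \<open>{0..<2}\<close>, so the embedding of the
      cylinder \<open>X\<close> is \<open>X\<close> itself.\<close>
    from IT.emeasure_CI[of ?J 2, OF _ X]
    show "emeasure (IT.CI ?J) X = emeasure (IT.C 0 2 ?u) X"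
      using prod_emb_id[of X ?J ?M] sets.sets_into_space[OF X] by (simp add: space_PiM)
  qed
  show ?thesis
  proof (rule measure_eqI)
    show "sets (distr ?L (\<pi> \<Otimes>\<^sub>M \<pi>) ?\<phi>) = sets (kernel_prod \<pi> \<pi> P)"
      by (simp add: sets_kernel_prod[OF P_kernel not_empty])
    fix D assume "D \<in> sets (distr ?L (\<pi> \<Otimes>\<^sub>M \<pi>) ?\<phi>)"
    then have D[measurable]: "D \<in> sets (\<pi> \<Otimes>\<^sub>M \<pi>)" by simp
    let ?g = "\<lambda>\<omega>. indicator D (?\<phi> \<omega>) :: ennreal"
    have g[measurable]: "?g \<in> borel_measurable (PiM ?J ?M)" by measurable
    \<comment> \<open>\<open>?\<phi>\<close> reads only times 0 and 1, so the path law can be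
      replaced by its marginal on \<open>?J\<close>.\<close>
    have "distr ?L (\<pi> \<Otimes>\<^sub>M \<pi>) ?\<phi> = distr (distr IT.PF.lim (PiM ?J ?M) (\<lambda>\<omega>. restrict \<omega> ?J)) (\<pi> \<Otimes>\<^sub>M \<pi>) ?\<phi>"
      unfolding L by (subst distr_distr[OF \<phi> r]) (simp add: comp_def)
    also have "\<dots> = distr (IT.C 0 2 ?u) (\<pi> \<Otimes>\<^sub>M \<pi>) ?\<phi>"
      by (subst IT.distr_lim) (simp_all add: CI)
    finally have "emeasure (distr ?L (\<pi> \<Otimes>\<^sub>M \<pi>) ?\<phi>) D = emeasure (distr (IT.C 0 2 ?u) (\<pi> \<Otimes>\<^sub>M \<pi>) ?\<phi>) D"
      by simp
    also have "\<dots> = (\<integral>\<^sup>+\<omega>. ?g \<omega> \<partial>IT.C 0 2 ?u)"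
      using \<phi> measurable_cong_sets[OF IT.sets_C[OF u, of 2] refl, of "\<pi> \<Otimes>\<^sub>M \<pi>"]
      by (subst nn_integral_indicator[symmetric], simp, subst nn_integral_distr) auto
    also have "\<dots> = (\<integral>\<^sup>+\<omega>. \<integral>\<^sup>+\<omega>'. ?g \<omega>' \<partial>IT.eP 1 \<omega> \<partial>IT.eP 0 ?u)"
      unfolding C2
    proof (rule nn_integral_bind[OF g])
      show "IT.eP 1 \<in> IT.eP 0 ?u \<rightarrow>\<^sub>M subprob_algebra (PiM ?J ?M)"
        using IT.measurable_eP[of 1] unfolding measurable_cong_sets[OF IT.sets_eP[OF u] refl]
        by (simp add: numeral_2_eq_2)
    qed
    also have "\<dots> = (\<integral>\<^sup>+v. \<integral>\<^sup>+\<omega>'. ?g \<omega>' \<partial>IT.eP 1 (?u(0 := v)) \<partial>?K 0 ?u)"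
    proof (rule IT.nn_integral_eP[OF u])
      show "(\<lambda>\<omega>. \<integral>\<^sup>+\<omega>'. ?g \<omega>' \<partial>IT.eP 1 \<omega>) \<in> borel_measurable (PiM {0..<Suc 0} ?M)"
        using measurable_compose[OF IT.measurable_eP[of 1] nn_integral_measurable_subprob_algebra[of ?g]] g
        by (simp add: numeral_2_eq_2)
    qed
    also have "\<dots> = (\<integral>\<^sup>+v. \<integral>\<^sup>+w. indicator D (snd v, snd w) \<partial>?k (snd v) \<partial>?K 0 ?u)"
    proof (rule nn_integral_cong)
      fix v assume "v \<in> space (?K 0 ?u)"
      then have v: "?u(0 := v) \<in> space (PiM {0..<1} ?M)"
        using IT.space_P[OF u] by (auto simp: space_PiM PiE_iff extensional_def)
      have "?g \<in> borel_measurable (PiM {0..<Suc 1} ?M)"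
        using g by (simp add: numeral_2_eq_2)
      from IT.nn_integral_eP[OF v this]
      show "(\<integral>\<^sup>+\<omega>'. ?g \<omega>' \<partial>IT.eP 1 (?u(0 := v))) = (\<integral>\<^sup>+w. indicator D (snd v, snd w) \<partial>?k (snd v))"
        by (simp add: Let_def)
    qed
    also have "\<dots> = (\<integral>\<^sup>+x. \<integral>\<^sup>+w. indicator D (x, snd w) \<partial>?k x \<partial>\<pi>)"
    proof -
      have e: "(\<lambda>x. ({}, x)) \<in> \<pi> \<rightarrow>\<^sub>M S \<Otimes>\<^sub>M \<pi>"
        by (intro measurable_Pair measurable_const) (simp_all add: space_finset_space)
      have "(\<lambda>x. \<integral>\<^sup>+w. indicator D (x, snd w) \<partial>?k x) \<in> borel_measurable \<pi>"
        using measurable_kernel_nn_integral[OF measurable_kernel_prod[OF Q_kernel \<kappa>_kernel],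
            of "\<lambda>z. indicator D (fst z, snd (snd z))"] by simp
      from measurable_compose[OF measurable_snd this, of S] show ?thesis
        unfolding chain_kernel.simps(1)
        by (subst nn_integral_distr[OF e]) (simp_all only: measurable_distr_eq1 snd_conv)
    qed
    also have "\<dots> = (\<integral>\<^sup>+x. \<integral>\<^sup>+y. indicator D (x, y) \<partial>P x \<partial>\<pi>)"
    proof (rule nn_integral_cong)
      fix x assume x: "x \<in> space \<pi>"
      have "(\<lambda>w. indicator D (x, snd w) :: ennreal) \<in> borel_measurable (Q x \<Otimes>\<^sub>M \<pi>)"
        using x by measurable
      from nn_integral_kernel_prod[OF \<kappa>_kernel_Q[OF x] this] 
      show "(\<integral>\<^sup>+w. indicator D (x, snd w) \<partial>kernel_prod (Q x) \<pi> (\<kappa> x)) =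
          (\<integral>\<^sup>+y. indicator D (x, y) \<partial>P x)"
        using x by (subst nn_integral_P) simp_all
    qed
    also have "\<dots> = emeasure (kernel_prod \<pi> \<pi> P) D"
      by (subst nn_integral_indicator[symmetric], simp add: sets_kernel_prod[OF P_kernel not_empty],
          subst nn_integral_kernel_prod[OF P_kernel]) auto
    finally show "emeasure (distr ?L (\<pi> \<Otimes>\<^sub>M \<pi>) ?\<phi>) D = emeasure (kernel_prod \<pi> \<pi> P) D" .
  qed
qed

lemma integral_chain_law:
  fixes g :: "_ \<Rightarrow> real"
  assumes "g \<in> borel_measurable (\<pi> \<Otimes>\<^sub>M \<pi>)"
  shows "(\<integral>\<omega>. g (snd (\<omega> 0), snd (\<omega> 1)) \<partial>chain_law \<pi> Q \<kappa> \<pi>) = (\<integral>z. g (fst (fst z), snd z) \<partial>T)"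
proof -
  interpret IT: Ionescu_Tulcea "chain_kernel \<pi> Q \<kappa> \<pi>" "\<lambda>_. S \<Otimes>\<^sub>M \<pi>"
    by (rule Ionescu_Tulcea_chain[OF Q \<kappa> prob_space_axioms refl])
  have "(\<lambda>\<omega>. (snd (\<omega> 0), snd (\<omega> 1))) \<in> PiM UNIV (\<lambda>_::nat. S \<Otimes>\<^sub>M \<pi>) \<rightarrow>\<^sub>M \<pi> \<Otimes>\<^sub>M \<pi>"
    by measurable
  then have "(\<lambda>\<omega>. (snd (\<omega> 0), snd (\<omega> 1))) \<in> chain_law \<pi> Q \<kappa> \<pi> \<rightarrow>\<^sub>M \<pi> \<Otimes>\<^sub>M \<pi>"
    unfolding chain_law_def measurable_cong_sets[OF IT.PF.sets_lim refl] .
  from integral_distr[OF this assms] show ?thesis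
    unfolding distr_chain_law integral_kernel_prod_P[OF assms] by simp
qed

section \<open>The Poisson equation and the asymptotic variances\<close>

lemma variance_of_centered:
  assumes "L2 \<pi> f"
  shows "variance_of \<pi> f = (\<integral>x. (f x - expectation f)\<^sup>2 \<partial>\<pi>)"
  using variance_eq[OF L2_integrable[OF assms]] assms by (simp add: variance_of_def L2_def)

context
  fixes f F :: "'a \<Rightarrow> real"
  assumes f: "L2 \<pi> f" and F: "L2 \<pi> F" and poisson: "poisson_solution \<pi> P f F"
begin

abbreviation "f\<^sub>0 \<equiv> \<lambda>x. f x - expectation f"

lemma L2_f0: "L2 \<pi> f\<^sub>0"
  by (rule L2_diff[OF f L2_const])

lemma kernel_op_F: "x \<in> space \<pi> \<Longrightarrow> kernel_op P F x = F x - f\<^sub>0 x"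
  using poisson by (simp add: poisson_solution_def algebra_simps)

text \<open>The Poisson equation replaces \<open>PF\<close> by \<open>F - f\<^sub>0\<close>.\<close>

lemma corr_F:
  assumes "L2 \<pi> h"
  shows "corr h F = (\<integral>x. h x * F x \<partial>\<pi>) - (\<integral>x. h x * f\<^sub>0 x \<partial>\<pi>)"
proof -
  have "corr h F = (\<integral>x. h x * F x - h x * f\<^sub>0 x \<partial>\<pi>)"
    unfolding corr_kernel_op[OF assms F]
    by (rule Bochner_Integration.integral_cong) (simp_all add: kernel_op_F right_diff_distrib)
  then show ?thesis
    using L2_integrable_mult[OF assms F] L2_integrable_mult[OF assms L2_f0]
    by (simp only: Bochner_Integration.integral_diff)
qed

text \<open>With \<open>PF = F - f\<^sub>0\<close> the integrand
  \<open>F\<^sup>2 - (PF)\<^sup>2\<close> becomes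
  \<open>2 F f\<^sub>0 - f\<^sub>0\<^sup>2\<close>.\<close>

lemma asymp_var_eq:
  "asymp_var \<pi> P F = 2 * (\<integral>x. F x * f\<^sub>0 x \<partial>\<pi>) - variance_of \<pi> f"
proof -
  have "asymp_var \<pi> P F = (\<integral>x. 2 * (F x * f\<^sub>0 x) - (f\<^sub>0 x)\<^sup>2 \<partial>\<pi>)"
    unfolding asymp_var_def
    by (rule Bochner_Integration.integral_cong)
      (simp_all add: kernel_op_F power2_eq_square algebra_simps)
  also have "\<dots> = 2 * (\<integral>x. F x * f\<^sub>0 x \<partial>\<pi>) - (\<integral>x. (f\<^sub>0 x)\<^sup>2 \<partial>\<pi>)"
    using L2_integrable_mult[OF F L2_f0] L2_f0 unfolding L2_def
    by (subst Bochner_Integration.integral_diff) auto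
  finally show ?thesis by (simp add: variance_of_centered[OF f])
qed

text \<open>The mean conditional variance is a quadratic form \<open>D\<close>, so
  \<open>D(h - F) - D(F) = D(h) - 2 D(h, F)\<close>. Its polar form
  \<open>D(h, F) = \<langle>\<pi>, h F\<rangle> - corr h F\<close> equals
  \<open>\<langle>\<pi>, h f\<^sub>0\<rangle>\<close> by \<open>corr_F\<close>.\<close>

lemma asymp_var_wr_eq:
  assumes h: "L2 \<pi> h"
  shows "asymp_var_wr \<pi> Q \<kappa> F h = asymp_var \<pi> P F
    + ((\<integral>x. (h x)\<^sup>2 \<partial>\<pi>) - corr h h) - 2 * (\<integral>x. h x * f\<^sub>0 x \<partial>\<pi>)"
proof -
  note hF = L2_diff[OF h F]
  have "(\<integral>(x, A). variance_of (\<kappa> x A) (\<lambda>y. h y - F y) - variance_of (\<kappa> x A) F \<partial>N) =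
      (\<integral>x. (h x - F x)\<^sup>2 \<partial>\<pi>) - corr (\<lambda>y. h y - F y) (\<lambda>y. h y - F y) - ((\<integral>x. (F x)\<^sup>2 \<partial>\<pi>) - corr F F)"
    using integral_variance_sel[OF hF] integral_variance_sel[OF F]
      integrable_variance_sel[OF hF] integrable_variance_sel[OF F]
    by (simp add: case_prod_beta')
  also have "(\<integral>x. (h x - F x)\<^sup>2 \<partial>\<pi>) = (\<integral>x. (h x)\<^sup>2 + (F x)\<^sup>2 - 2 * (h x * F x) \<partial>\<pi>)"
    by (simp add: power2_diff mult.assoc)
  also have "\<dots> = (\<integral>x. (h x)\<^sup>2 \<partial>\<pi>) + (\<integral>x. (F x)\<^sup>2 \<partial>\<pi>) - 2 * (\<integral>x. h x * F x \<partial>\<pi>)"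
    using h F L2_integrable_mult[OF h F] by (simp add: L2_def)
  also have "corr (\<lambda>y. h y - F y) (\<lambda>y. h y - F y) = corr h h - 2 * corr h F + corr F F"
    using corr_sym[OF h F] by (simp add: corr_diff_left[OF h F hF] corr_diff_right[OF h F h] corr_diff_right[OF h F F])
  finally show ?thesis
    by (simp add: asymp_var_wr_def corr_F[OF h])
qed

text \<open>By \<open>corr_F\<close> the Dirichlet form of \<open>F\<close> is
  \<open>\<langle>\<pi>, F f\<^sub>0\<rangle>\<close>, so both sides equal
  \<open>\<langle>\<pi>, F f\<^sub>0\<rangle>\<close> minus the variance of
  \<open>f\<close>.\<close>

lemma asymp_var_wr_F: "asymp_var_wr \<pi> Q \<kappa> F F = 1 / 2 * (asymp_var \<pi> P F - variance_of \<pi> f)"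
  using corr_F[OF F] by (simp add: asymp_var_wr_eq[OF F] asymp_var_eq power2_eq_square)

lemma integral_f_f0: "(\<integral>x. f x * f\<^sub>0 x \<partial>\<pi>) = variance_of \<pi> f"
proof -
  have "(\<integral>x. f x * f\<^sub>0 x \<partial>\<pi>) = (\<integral>x. (f x)\<^sup>2 - expectation f * f x \<partial>\<pi>)"
    by (simp add: power2_eq_square right_diff_distrib mult.commute)
  also have "\<dots> = (\<integral>x. (f x)\<^sup>2 \<partial>\<pi>) - (expectation f)\<^sup>2"
    using f L2_integrable[OF f] by (simp add: L2_def power2_eq_square)
  finally show ?thesis by (simp add: variance_of_def)
qed

text \<open>A quadratic polynomial in \<open>b\<close> with the Dirichlet form of \<open>f\<close>
  as leading coefficient; it serves both \<open>b = 1\<close> and the minimisation.\<close>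

lemma asymp_var_wr_cmult_f:
  "asymp_var_wr \<pi> Q \<kappa> F (\<lambda>x. b * f x) = asymp_var \<pi> P F
    + b\<^sup>2 * ((\<integral>x. (f x)\<^sup>2 \<partial>\<pi>) - corr f f) - 2 * b * variance_of \<pi> f"
  unfolding asymp_var_wr_eq[OF L2_cmult[OF f]]
  using integral_f_f0
  by (simp add: corr_cmult_left corr_cmult_right power_mult_distrib mult.assoc)
     (simp add: algebra_simps power2_eq_square)

text \<open>The Dirichlet form sees only differences of values, so centering \<open>f\<close> leaves
  it unchanged.\<close>

lemma corr_f_f: "(\<integral>x. (f x)\<^sup>2 \<partial>\<pi>) - corr f f = variance_of \<pi> f - corr f\<^sub>0 f\<^sub>0"
  unfolding variance_of_centered[OF f] dirichlet_form(1)[OF f] dirichlet_form(1)[OF L2_f0] by simp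

lemma Delta_eq: "Delta \<pi> P f = variance_of \<pi> f + corr f\<^sub>0 f\<^sub>0"
proof -
  have [measurable]: "f \<in> borel_measurable \<pi>" using f by (simp add: L2_def)
  have "(\<lambda>z. (f\<^sub>0 (fst z) + f\<^sub>0 (snd z))\<^sup>2) \<in> borel_measurable (\<pi> \<Otimes>\<^sub>M \<pi>)" by measurable
  from integral_kernel_prod_P[OF this] show ?thesis
    unfolding Delta_def Let_def variance_of_centered[OF f] dirichlet_form(2)[OF L2_f0]
    by (simp add: case_prod_beta')
qed

text \<open>At \<open>b = 1\<close> the correction is the Dirichlet form minus twice the variance,
  that is, \<open>- variance_of \<pi> f - corr f\<^sub>0 f\<^sub>0\<close>.\<close>

lemma asymp_var_wr_f: "asymp_var_wr \<pi> Q \<kappa> F f = asymp_var \<pi> P F - Delta \<pi> P f"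
  using asymp_var_wr_cmult_f[of 1] by (simp add: Delta_eq corr_f_f)

lemma variance_of_f_nonneg: "variance_of \<pi> f \<ge> 0"
  unfolding variance_of_centered[OF f] by simp

text \<open>By \<open>corr_sel\<close> this is the integral of a square: in the Boltzmann case
  \<open>P\<close> is a nonnegative operator.\<close>

lemma corr_self_nonneg: "L2 \<pi> h \<Longrightarrow> corr h h \<ge> 0"
  by (simp add: corr_sel)

text \<open>The excess is \<open>corr f\<^sub>0 f\<^sub>0\<close>. The bound gives nonnegativity of
  \<open>Delta\<close> and its positivity when the variance is positive.\<close>

lemma Delta_ge: "Delta \<pi> P f \<ge> variance_of \<pi> f"
  using corr_self_nonneg[OF L2_f0] by (simp add: Delta_eq)

lemma integral_f_kernel_op: "(\<integral>x. (f x)\<^sup>2 - f x * kernel_op P f x \<partial>\<pi>) = (\<integral>x. (f x)\<^sup>2 \<partial>\<pi>) - corr f f"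
  using f integrable_kernel_op[OF f f] by (simp add: L2_def corr_kernel_op[OF f f])

lemma dirichlet_pos:
  assumes "variance_of \<pi> f > 0"
  shows "(\<integral>x. (f x)\<^sup>2 \<partial>\<pi>) - corr f f > 0"
proof (rule ccontr)
  let ?d = "\<lambda>z. f (fst (fst z)) - f (snd z)"
  assume "\<not> ?thesis"
  moreover have "(\<integral>z. (?d z)\<^sup>2 \<partial>T) \<ge> 0" by simp
  ultimately have "(\<integral>z. (?d z)\<^sup>2 \<partial>T) = 0"
    unfolding dirichlet_form(1)[OF f] by linarith
  moreover have "integrable T (\<lambda>z. (?d z)\<^sup>2)"
    using L2_diff[OF L2_state[OF f] L2_next[OF f]] by (simp add: L2_def)
  ultimately have "AE z in T. (?d z)\<^sup>2 = 0"
    by (subst (asm) integral_nonneg_eq_0_iff_AE) auto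
  then have e: "AE z in T. f (snd z) = f (fst (fst z))"
    by eventually_elim simp
  have [measurable]: "f \<in> borel_measurable \<pi>" "F \<in> borel_measurable \<pi>"
    using f F by (auto simp: L2_def)
  have m: "(\<lambda>z. F (fst (fst z)) * f (snd z)) \<in> borel_measurable T"
     "(\<lambda>z. F (fst (fst z)) * f (fst (fst z))) \<in> borel_measurable T"
    unfolding measurable_T by measurable
  \<comment> \<open>Since \<open>f\<close> takes the same value at both states almost everywhere,
    the next state may be replaced by the current one.\<close>
  have "corr F f = (\<integral>z. F (fst (fst z)) * f (fst (fst z)) \<partial>T)"
    unfolding corr_def using e by (intro integral_cong_AE m) auto
  also have "\<dots> = (\<integral>x. F x * f x \<partial>\<pi>)"
    by (rule integral_state) simp
  \<comment> \<open>By symmetry \<open>corr f F\<close> is the full product integral, whereas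
    \<open>corr_F\<close> makes it fall short of that by the variance of \<open>f\<close>.\<close>
  finally have "variance_of \<pi> f = 0"
    using corr_F[OF f] corr_sym[OF f F] integral_f_f0 by (simp add: mult.commute)
  with assms show False by simp
qed

lemma asymp_var_wr_f_eq_0:
  assumes "corr f\<^sub>0 f\<^sub>0 = 0"
  shows "asymp_var_wr \<pi> Q \<kappa> F f = 0"
proof -
  have "(\<integral>z. sel f\<^sub>0 z * sel f\<^sub>0 z \<partial>N) = 0"
    using assms by (simp add: corr_sel L2_f0)
  then have "AE z in N. sel f\<^sub>0 z * sel f\<^sub>0 z = 0"
    using L2_integrable_mult[OF L2_sel[OF L2_f0] L2_sel[OF L2_f0]]
    by (subst (asm) integral_nonneg_eq_0_iff_AE) auto
  \<comment> \<open>A vanishing square integral forces \<open>sel f\<^sub>0 = 0\<close> almost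
    everywhere, which also kills its product with \<open>sel F\<close>.\<close>
  then have "AE z in N. sel f\<^sub>0 z * sel F z = 0"
    by eventually_elim simp
  then have "corr f\<^sub>0 F = 0"
    unfolding corr_sel[OF L2_f0 F] by (simp add: integral_eq_zero_AE)
  \<comment> \<open>Consequently \<open>asymp_var\<close> and \<open>Delta\<close> both equal the
    variance of \<open>f\<close>, and their difference is 0.\<close>
  then have "(\<integral>x. F x * f\<^sub>0 x \<partial>\<pi>) = variance_of \<pi> f"
    using corr_F[OF L2_f0] by (simp add: variance_of_centered[OF f] power2_eq_square mult.commute)
  with assms show ?thesis
    by (simp add: asymp_var_wr_f asymp_var_eq Delta_eq)
qed

lemma b_star_eq: "b_star \<pi> P f = variance_of \<pi> f / ((\<integral>x. (f x)\<^sup>2 \<partial>\<pi>) - corr f f)"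
  unfolding b_star_def integral_f_kernel_op by (simp add: variance_of_def)

lemma b_star_minimal:
  assumes "variance_of \<pi> f > 0"
  shows "asymp_var_wr \<pi> Q \<kappa> F (\<lambda>x. b_star \<pi> P f * f x) \<le> asymp_var_wr \<pi> Q \<kappa> F (\<lambda>x. b * f x)"
proof -
  define D where "D = (\<integral>x. (f x)\<^sup>2 \<partial>\<pi>) - corr f f"
  have "D > 0" using dirichlet_pos[OF assms] by (simp add: D_def)
  then have V: "variance_of \<pi> f = b_star \<pi> P f * D"
    by (simp add: b_star_eq flip: D_def)
  \<comment> \<open>Completing the square: this is exactly the difference of the two sides of the
    claim.\<close>
  have "0 \<le> D * (b - b_star \<pi> P f)\<^sup>2"
    using \<open>D > 0\<close> by simp
  then show ?thesis
    unfolding asymp_var_wr_cmult_f V D_def[symmetric]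
    by (simp add: power2_eq_square algebra_simps)
qed

text \<open>The denominator of \<open>b_star\<close> is the variance minus
  \<open>corr f\<^sub>0 f\<^sub>0\<close>, so the ratio exceeds 1 once that correlation is positive;
  were it 0, \<open>asymp_var_wr_f_eq_0\<close> would apply.\<close>

lemma b_star_gt_1:
  assumes "variance_of \<pi> f > 0" "asymp_var_wr \<pi> Q \<kappa> F f > 0"
  shows "b_star \<pi> P f > 1"
proof -
  have "corr f\<^sub>0 f\<^sub>0 > 0"
    using corr_self_nonneg[OF L2_f0] asymp_var_wr_f_eq_0 assms(2) by force
  then show ?thesis
    using dirichlet_pos[OF assms(1)] unfolding b_star_eq corr_f_f by simp
qed

end

end

section \<open>From Boltzmann weights to equality of selection laws\<close>

lemma prob_measure_eqI_point_masses:
  assumes "prob_space M" "prob_space N" and sets: "sets M = sets N"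
    and "finite A" and singleton: "\<And>x. x \<in> A \<Longrightarrow> {x} \<in> sets N"
    and A: "measure M A = 1" "measure N A = 1"
    and eq: "\<And>x. x \<in> A \<Longrightarrow> measure M {x} = measure N {x}"
  shows "M = N"
proof (rule measure_eqI[OF sets])
  interpret M: prob_space M by fact
  interpret N: prob_space N by fact
  fix X assume X: "X \<in> sets M"
  have "(\<Union>x\<in>B. {x}) \<in> sets N" if "B \<subseteq> A" for B
    using that \<open>finite A\<close> singleton by (intro sets.finite_UN) (auto intro: finite_subset)
  then have fin: "B \<in> sets N" if "B \<subseteq> A" for B using that by simp
  \<comment> \<open>\<open>A\<close> carries all the mass, so only the finite set
    \<open>X \<inter> A\<close> counts, and it is a sum of point masses.\<close>
  have "measure M X = measure M (X \<inter> A)"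
    using M.AE_prob_1[OF A(1)] X fin[of "X \<inter> A"] sets by (intro M.finite_measure_eq_AE) auto
  also have "\<dots> = (\<Sum>x\<in>X \<inter> A. measure M {x})"
    using \<open>finite A\<close> singleton sets by (intro M.finite_measure_eq_sum_singleton) auto
  also have "\<dots> = (\<Sum>x\<in>X \<inter> A. measure N {x})"
    using eq by simp
  also have "\<dots> = measure N (X \<inter> A)"
    using \<open>finite A\<close> singleton by (intro N.finite_measure_eq_sum_singleton[symmetric]) auto
  also have "\<dots> = measure N X"
    using N.AE_prob_1[OF A(2)] X fin[of "X \<inter> A"] sets by (intro N.finite_measure_eq_AE) auto
  finally show "emeasure M X = emeasure N X"
    by (simp add: M.emeasure_eq_measure N.emeasure_eq_measure)
qed

text \<open>The weights depend on \<open>A\<close> and the selected point only, and a probability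
  measure carried by the finite set \<open>A\<close> is determined by its point masses.\<close>

lemma boltzmann_kernel_const:
  assumes singleton: "\<And>x. x \<in> space \<pi> \<Longrightarrow> {x} \<in> sets \<pi>"
    and \<kappa>: "selection_kernel \<pi> Q \<kappa>" and B: "is_boltzmann_kernel \<pi> r \<kappa>"
    and A: "A \<in> space (finset_space \<pi>)" and x: "x \<in> A" and y: "y \<in> A"
  shows "\<kappa> x A = \<kappa> y A"
proof (rule prob_measure_eqI_point_masses)
  have A': "finite A" "A \<subseteq> space \<pi>" using A by (auto simp: space_finset_space)
  then have xy: "x \<in> space \<pi>" "y \<in> space \<pi>" using x y by auto
  have K: "(\<lambda>(x, A). \<kappa> x A) \<in> \<pi> \<Otimes>\<^sub>M finset_space \<pi> \<rightarrow>\<^sub>M prob_algebra \<pi>"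
    using \<kappa> by (simp add: selection_kernel_def)
  have p: "prob_space (\<kappa> z A)" "sets (\<kappa> z A) = sets \<pi>" if "z \<in> space \<pi>" for z
    using prob_kernelD[OF K, of "(z, A)"] that A by (simp_all add: space_pair_measure)
  show "prob_space (\<kappa> x A)" "prob_space (\<kappa> y A)" "sets (\<kappa> x A) = sets (\<kappa> y A)"
    using p xy by auto
  show "finite A" by (rule A')
  show "{z} \<in> sets (\<kappa> y A)" if "z \<in> A" for z
    using that A' p(2)[OF xy(2)] singleton by auto
  show "measure (\<kappa> x A) A = 1" "measure (\<kappa> y A) A = 1"
    using \<kappa> A x y by (auto simp: selection_kernel_def)
  show "measure (\<kappa> x A) {z} = measure (\<kappa> y A) {z}" if "z \<in> A" for z
    using B A x y that by (simp add: is_boltzmann_kernel_def)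
qed

theorem proposition4p1:
  fixes \<pi> :: "'a measure"
    and Q :: "'a \<Rightarrow> 'a set measure"
    and \<kappa> :: "'a \<Rightarrow> 'a set \<Rightarrow> 'a measure"
    and N\<^sub>0 :: "'a set measure"
    and r :: "'a set \<Rightarrow> 'a \<Rightarrow> real"
    and f F :: "'a \<Rightarrow> real"
  defines "P \<equiv> transition_kernel Q \<kappa>"
  assumes "prob_space \<pi>"
    and "\<And>x. x \<in> space \<pi> \<Longrightarrow> {x} \<in> sets \<pi>"
    and "proposition_kernel \<pi> Q"
    and "selection_kernel \<pi> Q \<kappa>"
    and "boltzmann_disintegration \<pi> Q N\<^sub>0 r"
    and "is_boltzmann_kernel \<pi> r \<kappa>"
    and "harris_recurrent \<pi> Q \<kappa>"
    and "f \<in> borel_measurable \<pi>" and "integrable \<pi> (\<lambda>x. (f x)\<^sup>2)"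
    and "poisson_solution \<pi> P f F" and "integrable \<pi> (\<lambda>x. (F x)\<^sup>2)"
  shows "asymp_var_wr \<pi> Q \<kappa> F F = 1 / 2 * (asymp_var \<pi> P F - variance_of \<pi> f) \<and>
    asymp_var_wr \<pi> Q \<kappa> F f = asymp_var \<pi> P F - Delta \<pi> P f \<and>
    Delta \<pi> P f \<ge> 0 \<and>
    (variance_of \<pi> f > 0 \<longrightarrow> Delta \<pi> P f > 0) \<and>
    (variance_of \<pi> f > 0 \<longrightarrow>
       (\<integral>x. (f x)\<^sup>2 - f x * kernel_op P f x \<partial>\<pi>) =
         1 / 2 * (\<integral>\<omega>. (f (snd (\<omega> 0)) - f (snd (\<omega> 1)))\<^sup>2 \<partial>chain_law \<pi> Q \<kappa> \<pi>) \<and>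
       (\<integral>x. (f x)\<^sup>2 - f x * kernel_op P f x \<partial>\<pi>) > 0 \<and>
       (\<forall>b. asymp_var_wr \<pi> Q \<kappa> F (\<lambda>x. b_star \<pi> P f * f x) \<le> asymp_var_wr \<pi> Q \<kappa> F (\<lambda>x. b * f x)) \<and>
       (asymp_var_wr \<pi> Q \<kappa> F f > 0 \<longrightarrow> b_star \<pi> P f > 1))"
proof -
  \<comment> \<open>The Boltzmann weights enter here, through
    \<open>boltzmann_kernel_const\<close>.\<close>
  interpret boltzmann_selection \<pi> Q \<kappa>
    by (rule boltzmann_selection.intro[OF assms(2) boltzmann_selection_axioms.intro[OF assms(3-5)
          boltzmann_kernel_const[OF assms(3,5,7)]]])
  have f: "L2 \<pi> f" and F: "L2 \<pi> F"
    using assms(9-12) by (auto simp: L2_def poisson_solution_def)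
  note poisson = assms(11)[unfolded P_def]
  note facts = asymp_var_wr_F[OF f F poisson] asymp_var_wr_f[OF f F poisson] Delta_ge[OF f F poisson]
  have "(\<lambda>z. (f (fst z) - f (snd z))\<^sup>2) \<in> borel_measurable (\<pi> \<Otimes>\<^sub>M \<pi>)"
    using assms(9) by measurable
  \<comment> \<open>The path-space expectation passes to the triple law, where it is twice the
    Dirichlet form of \<open>f\<close>.\<close>
  from integral_chain_law[OF this]
  have chain: "(\<integral>x. (f x)\<^sup>2 - f x * kernel_op (transition_kernel Q \<kappa>) f x \<partial>\<pi>) =
      1 / 2 * (\<integral>\<omega>. (f (snd (\<omega> 0)) - f (snd (\<omega> 1)))\<^sup>2 \<partial>chain_law \<pi> Q \<kappa> \<pi>)"
    by (simp only: integral_f_kernel_op[OF f F poisson] dirichlet_form(1)[OF f] fst_conv snd_conv)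
  show ?thesis
    unfolding P_def
  proof (intro conjI impI allI)
    assume V: "variance_of \<pi> f > 0"
    show "Delta \<pi> (transition_kernel Q \<kappa>) f > 0"
      using V Delta_ge[OF f F poisson] by linarith
    show "(\<integral>x. (f x)\<^sup>2 - f x * kernel_op (transition_kernel Q \<kappa>) f x \<partial>\<pi>) > 0"
      unfolding integral_f_kernel_op[OF f F poisson] by (rule dirichlet_pos[OF f F poisson V])
    show "asymp_var_wr \<pi> Q \<kappa> F (\<lambda>x. b_star \<pi> (transition_kernel Q \<kappa>) f * f x)
        \<le> asymp_var_wr \<pi> Q \<kappa> F (\<lambda>x. b * f x)" for b
      by (rule b_star_minimal[OF f F poisson V])
    show "b_star \<pi> (transition_kernel Q \<kappa>) f > 1" if "asymp_var_wr \<pi> Q \<kappa> F f > 0"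
      by (rule b_star_gt_1[OF f F poisson V that])
  next
    show "Delta \<pi> (transition_kernel Q \<kappa>) f \<ge> 0"
      using Delta_ge[OF f F poisson] variance_of_f_nonneg[OF f F poisson] by linarith
  qed (rule facts chain)+
qed

end
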